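(* Let $q=2^r$ ($r\ge1$) and let $\mathbb{G}_q$ be the Galois ring of characteristic $4$ with $q^2$ elements. Then there exists a projective $\bigl((q^4-q)/2,\,q^2/2\bigr)$-arc in $\mathrm{PHG}(2,\mathbb{G}_q)$ which meets every line in either $0$ or $q^2/2$ points. Moreover $\mathrm{m}_{q^2/2}(\mathbb{G}_q)=(q^4-q)/2$.
   Context: The Galois ring $\mathbb{G}_q$ ($q=2^r$) is $\mathbb{Z}_4[X]/(h)$ with $h\in\mathbb{Z}_4[X]$ monic of degree $r$ and irreducible modulo $2$; it is a chain ring of length $2$ with residue field $\mathbb{F}_q$. The projective Hjelmslev plane $\mathrm{PHG}(2,R)$ is the incidence structure whose points are the free rank-$1$ submodules of the right module $R_R^3$, whose lines are the free rank-$2$ submodules of $R_R^3$, with incidence given by inclusion. A projective $(k,n)$-arc is a set of $k$ points meeting every line in at most $n$ points. For $0\le n\le q^2+q$, $\mathrm{m}_n(R)$ denotes the largest $k$ such that a projective $(k,n)$-arc exists in $\mathrm{PHG}(2,R)$. *)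

theory Defs
  imports "HOL-Algebra.QuotRing" "HOL-Library.Numeral_Type" "HOL-Library.FuncSet"
    "HOL-Computational_Algebra.Polynomial" "HOL-Computational_Algebra.Factorial_Ring"
begin

text \<open>Z_4 is the numeral type 4 (integers mod 4); Z_4[X] is the type-class
  polynomial ring over it, viewed as an HOL-Algebra ring record.\<close>

definition Z4poly_ring :: "(4 poly) ring" where
  "Z4poly_ring = \<lparr>carrier = UNIV, monoid.mult = (*), one = 1, ring.zero = 0, ring.add = (+)\<rparr>"

definition red2 :: "4 poly \<Rightarrow> 2 poly" where
  "red2 h = map_poly (\<lambda>a. of_int (Rep_bit0 a)) h"

definition galois_modulus :: "nat \<Rightarrow> 4 poly \<Rightarrow> bool" where
  "galois_modulus r h \<longleftrightarrow> lead_coeff h = 1 \<and> degree h = r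
      \<and> Factorial_Ring.irreducible (red2 h)"

definition galois_ring :: "4 poly \<Rightarrow> (4 poly set) ring" where
  "galois_ring h = Z4poly_ring Quot (PIdl\<^bsub>Z4poly_ring\<^esub> h)"

definition vecs3 :: "('a, 'b) ring_scheme \<Rightarrow> (nat \<Rightarrow> 'a) set" where
  "vecs3 R = {0..<3} \<rightarrow>\<^sub>E carrier R"

definition vsmul :: "('a, 'b) ring_scheme \<Rightarrow> (nat \<Rightarrow> 'a) \<Rightarrow> 'a \<Rightarrow> (nat \<Rightarrow> 'a)" where
  "vsmul R v a = (\<lambda>i\<in>{0..<3}. v i \<otimes>\<^bsub>R\<^esub> a)"

definition vadd :: "('a, 'b) ring_scheme \<Rightarrow> (nat \<Rightarrow> 'a) \<Rightarrow> (nat \<Rightarrow> 'a) \<Rightarrow> (nat \<Rightarrow> 'a)" where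
  "vadd R v w = (\<lambda>i\<in>{0..<3}. v i \<oplus>\<^bsub>R\<^esub> w i)"

text \<open>Free rank-1 submodules: x R with {x} a basis.\<close>
definition PHG_points :: "('a, 'b) ring_scheme \<Rightarrow> (nat \<Rightarrow> 'a) set set" where
  "PHG_points R = {M. \<exists>x \<in> vecs3 R.
      M = {vsmul R x a | a. a \<in> carrier R} \<and> inj_on (vsmul R x) (carrier R)}"

text \<open>Free rank-2 submodules: x R + y R with {x,y} a basis.\<close>
definition PHG_lines :: "('a, 'b) ring_scheme \<Rightarrow> (nat \<Rightarrow> 'a) set set" where
  "PHG_lines R = {M. \<exists>x \<in> vecs3 R. \<exists>y \<in> vecs3 R.
      M = {vadd R (vsmul R x a) (vsmul R y b) | a b. a \<in> carrier R \<and> b \<in> carrier R}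
      \<and> inj_on (\<lambda>(a, b). vadd R (vsmul R x a) (vsmul R y b)) (carrier R \<times> carrier R)}"

definition proj_arc :: "('a, 'b) ring_scheme \<Rightarrow> (nat \<Rightarrow> 'a) set set \<Rightarrow> nat \<Rightarrow> nat \<Rightarrow> bool" where
  "proj_arc R K k n \<longleftrightarrow> K \<subseteq> PHG_points R \<and> card K = k
      \<and> (\<forall>L \<in> PHG_lines R. card {P \<in> K. P \<subseteq> L} \<le> n)"

definition max_arc :: "('a, 'b) ring_scheme \<Rightarrow> nat \<Rightarrow> nat" where
  "max_arc R n = Max {k. \<exists>K. proj_arc R K k n}"

end

theory Submission
  imports Defs "HOL-Library.Product_Plus"
begin

text \<open>
  Let \<open>c\<close> be such that \<open>\<theta>\<^sup>3 + \<theta> + c\<close> is irreducible modulo 2, so that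
  \<open>S = R[\<theta>]/(\<theta>\<^sup>3 + \<theta> + c)\<close> is a free \<open>R\<close>-module of rank 3. Over \<open>R\<close>, where \<open>4 = 0\<close>, a square
  \<open>u\<^sup>2\<close> in \<open>S\<close> depends only on \<open>u\<close> modulo 2, hence the points \<open>u\<^sup>2 R\<close> with \<open>u \<notin> 2S\<close> meet each of the
  \<open>q\<^sup>2 + q + 1\<close> neighbour classes exactly once. If three of them were collinear, \<open>u\<^sub>1 u\<^sub>2\<close> would be
  an \<open>R\<close>-combination of \<open>u\<^sub>1\<^sup>2\<close> and \<open>u\<^sub>2\<^sup>2\<close> modulo 2, and \<open>u\<^sub>1 / u\<^sub>2\<close> would be quadratic over the residue
  field inside its cubic extension. So these points form a hyperoval: every line meets it in 0 or 2
  points. The lines missing it, read as points of the dual plane, are the required arc.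

  For the upper bound, count the lines through a point of an arc whose neighbour class contains \<open>u\<close>
  points of the arc: this bounds the size by a decreasing function of \<open>u\<close>, equal to \<open>(q\<^sup>4 - q)/2\<close> at
  \<open>u = (q\<^sup>2 - q)/2\<close>. If instead every class has at most \<open>(q\<^sup>2 - q)/2\<close> points, summing over the
  classes gives the same bound.
\<close>

section \<open>Counting modulo a subgroup\<close>

text \<open>A finite quotient group is handled as a congruence \<open>Z\<close> on a type together
  with a finite system \<open>C\<close> of representatives, so that its subsets are counted inside
  \<open>C\<close> and no quotient type is formed.\<close>

locale transversal =
  fixes Z :: "'g::ab_group_add \<Rightarrow> bool" and C :: "'g set"
  assumes zero: "Z 0"
    and diff: "Z x \<Longrightarrow> Z y \<Longrightarrow> Z (x - y)"
    and finite: "finite C"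
    and ex1: "\<exists>!c. c \<in> C \<and> Z (x - c)"
begin

definition rep :: "'g \<Rightarrow> 'g" where
  "rep x = (THE c. c \<in> C \<and> Z (x - c))"

lemma rep: "rep x \<in> C" "Z (x - rep x)"
  using theI'[OF ex1[of x]] unfolding rep_def by auto

lemma uminus: "Z x \<Longrightarrow> Z (- x)"
  using diff[OF zero] by force

lemma add: "Z x \<Longrightarrow> Z y \<Longrightarrow> Z (x + y)"
  using diff[of x "- y"] uminus[of y] by simp

lemma cong_sym: "Z (x - y) \<Longrightarrow> Z (y - x)"
  using uminus[of "x - y"] by simp

lemma cong_trans: "Z (x - y) \<Longrightarrow> Z (y - z) \<Longrightarrow> Z (x - z)"
  using add[of "x - y" "y - z"] by simp

lemma eq_if_cong: "x \<in> C \<Longrightarrow> y \<in> C \<Longrightarrow> Z (x - y) \<Longrightarrow> x = y"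
  using ex1[of x] zero by (metis diff_self)

end

lemma transversal_Times:
  assumes "transversal Z C" "transversal Z' C'"
  shows "transversal (\<lambda>(x, y). Z x \<and> Z' y) (C \<times> C')"
proof -
  interpret A: transversal Z C by fact
  interpret B: transversal Z' C' by fact
  show ?thesis
  proof
    fix x :: "'a \<times> 'b"
    show "\<exists>!c. c \<in> C \<times> C' \<and> (case x - c of (x, y) \<Rightarrow> Z x \<and> Z' y)"
    proof (rule ex1I[of _ "(A.rep (fst x), B.rep (snd x))"])
      show "(A.rep (fst x), B.rep (snd x)) \<in> C \<times> C' \<and>
        (case x - (A.rep (fst x), B.rep (snd x)) of (x, y) \<Rightarrow> Z x \<and> Z' y)"
        using A.rep B.rep by (cases x) auto
    next
      fix c assume "c \<in> C \<times> C' \<and> (case x - c of (x, y) \<Rightarrow> Z x \<and> Z' y)"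
      then show "c = (A.rep (fst x), B.rep (snd x))"
        using A.rep[of "fst x"] B.rep[of "snd x"] A.ex1[of "fst x"] B.ex1[of "snd x"]
        by (cases x; cases c) auto
    qed
  qed (use A.zero B.zero A.diff B.diff A.finite B.finite in \<open>auto simp: zero_prod_def\<close>)
qed

text \<open>As \<open>P\<close> and \<open>Q\<close> are unions of classes, \<open>f\<close> induces
  a bijection between the corresponding subsets of the quotients. On representatives it is realised
  by \<open>f\<close> followed by reduction to \<open>C'\<close>.\<close>

lemma card_transversal_eq:
  assumes "transversal Z C" "transversal Z' C'"
    and P: "\<And>x y. P x \<Longrightarrow> Z (x - y) \<Longrightarrow> P y"
    and Q: "\<And>x y. Q x \<Longrightarrow> Z' (x - y) \<Longrightarrow> Q y"
    and f: "\<And>x. P x \<Longrightarrow> Q (f x)"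
    and resp: "\<And>x y. P x \<Longrightarrow> P y \<Longrightarrow> Z (x - y) \<Longrightarrow> Z' (f x - f y)"
    and inj: "\<And>x y. P x \<Longrightarrow> P y \<Longrightarrow> Z' (f x - f y) \<Longrightarrow> Z (x - y)"
    and sur: "\<And>y. Q y \<Longrightarrow> \<exists>x. P x \<and> Z' (f x - y)"
  shows "card {c \<in> C. P c} = card {c \<in> C'. Q c}"
proof -
  interpret A: transversal Z C by fact
  interpret B: transversal Z' C' by fact
  have "bij_betw (\<lambda>c. B.rep (f c)) {c \<in> C. P c} {c \<in> C'. Q c}"
    unfolding bij_betw_def
  proof
    show "inj_on (\<lambda>c. B.rep (f c)) {c \<in> C. P c}"
    proof (rule inj_onI)
      fix x y assume *: "x \<in> {c \<in> C. P c}" "y \<in> {c \<in> C. P c}" "B.rep (f x) = B.rep (f y)"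
      have "Z' (f x - f y)"
        using B.rep(2)[of "f x"] B.cong_sym[OF B.rep(2)[of "f y"]] *(3) by (metis B.cong_trans)
      then show "x = y" using * inj A.eq_if_cong by auto
    qed
    show "(\<lambda>c. B.rep (f c)) ` {c \<in> C. P c} = {c \<in> C'. Q c}"
    proof (intro equalityI subsetI)
      fix d assume "d \<in> (\<lambda>c. B.rep (f c)) ` {c \<in> C. P c}"
      then obtain x where x: "x \<in> C" "P x" "d = B.rep (f x)" by auto
      show "d \<in> {c \<in> C'. Q c}" using B.rep(1) Q[OF f[OF x(2)] B.rep(2)] x(3) by simp
    next
      fix d assume d: "d \<in> {c \<in> C'. Q c}"
      then obtain x where x: "P x" "Z' (f x - d)" using sur by blast
      have "P (A.rep x)" using P[OF x(1) A.rep(2)] .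
      moreover have "Z' (f (A.rep x) - d)"
        using B.cong_trans[OF B.cong_sym[OF resp[OF x(1) \<open>P (A.rep x)\<close> A.rep(2)]] x(2)] .
      then have "Z' (d - B.rep (f (A.rep x)))"
        using B.cong_trans[OF B.cong_sym B.rep(2)] by simp
      then have "d = B.rep (f (A.rep x))" using d B.rep(1) B.eq_if_cong by auto
      ultimately show "d \<in> (\<lambda>c. B.rep (f c)) ` {c \<in> C. P c}" using A.rep(1) by blast
    qed
  qed
  then show ?thesis by (rule bij_betw_same_card)
qed

text \<open>Index formula for a homomorphism \<open>f\<close> from the subgroup \<open>P\<close>
  onto \<open>Q\<close>: every fibre is a translate of the kernel, and all of them have the same
  size.\<close>

lemma card_transversal_fibres:
  assumes "transversal Z C" "transversal Z' C'"
    and P: "\<And>x y. P x \<Longrightarrow> Z (x - y) \<Longrightarrow> P y"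
    and P_diff: "\<And>x y. P x \<Longrightarrow> P y \<Longrightarrow> P (x - y)"
    and f_diff: "\<And>x y. f (x - y) = f x - f y"
    and resp: "\<And>x. Z x \<Longrightarrow> Z' (f x)"
    and f: "\<And>x. P x \<Longrightarrow> Q (f x)"
    and Q: "\<And>x y. Q x \<Longrightarrow> Z' (x - y) \<Longrightarrow> Q y"
    and sur: "\<And>y. Q y \<Longrightarrow> \<exists>x. P x \<and> Z' (f x - y)"
  shows "card {c \<in> C. P c} = card {d \<in> C'. Q d} * card {c \<in> C. P c \<and> Z' (f c)}"
proof -
  interpret A: transversal Z C by fact
  interpret B: transversal Z' C' by fact
  have P_uminus: "P (- x)" if "P x" for x
    using P_diff[OF P_diff[OF that that] that] by simp
  have f_uminus: "f (- x) = - f x" for x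
    using f_diff[of "x - x" x] f_diff[of x x] by simp
  have P_add: "P (x + y)" if "P x" "P y" for x y
    using P_diff[OF that(1) P_uminus[OF that(2)]] by simp
  have f_add: "f (x + y) = f x + f y" for x y
    using f_diff[of x "- y"] by (simp add: f_uminus)
  have fib: "card {c \<in> C. P c \<and> Z' (f c - d)} = card {c \<in> C. P c \<and> Z' (f c)}" if d: "Q d" for d
  proof -
    \<comment> \<open>Subtracting one element \<open>z\<close> of the fibre over \<open>d\<close>
      carries this fibre to the kernel.\<close>
    obtain z where z: "P z" "Z' (f z - d)" using sur d by blast
    show ?thesis
    proof (rule card_transversal_eq[OF assms(1,1), where f = "\<lambda>x. x - z"])
      fix x y assume *: "P x \<and> Z' (f x - d)" "Z (x - y)"
      have "Z' (f x - f y)" using resp[OF *(2)] f_diff by simp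
      then show "P y \<and> Z' (f y - d)" using * P[of x y] B.cong_trans[OF B.cong_sym, of "f x" "f y" d] by simp
    next
      fix x y assume *: "P x \<and> Z' (f x)" "Z (x - y)"
      have "Z' (f x - f y)" using resp[OF *(2)] f_diff by simp
      then show "P y \<and> Z' (f y)" using * P[of x y] B.diff[of "f x" "f x - f y"] by simp
    next
      fix x assume *: "P x \<and> Z' (f x - d)"
      show "P (x - z) \<and> Z' (f (x - z))"
        using * z P_diff[of x z] f_diff B.diff[of "f x - d" "f z - d"] by simp
    next
      fix y assume *: "P y \<and> Z' (f y)"
      show "\<exists>x. (P x \<and> Z' (f x - d)) \<and> Z (x - z - y)"
        using * z P_add[of y z] f_add B.add[of "f y" "f z - d"] A.zero
        by (intro exI[of _ "y + z"]) (simp add: add_diff_eq)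
    qed simp_all
  qed
  have eq: "{c \<in> C. P c} = (\<Union>d\<in>{d \<in> C'. Q d}. {c \<in> C. P c \<and> Z' (f c - d)})"
  proof (intro equalityI subsetI)
    fix c assume c: "c \<in> {c \<in> C. P c}"
    then have "Q (B.rep (f c))" using Q[OF f B.rep(2)] by simp
    then show "c \<in> (\<Union>d\<in>{d \<in> C'. Q d}. {c \<in> C. P c \<and> Z' (f c - d)})"
      using B.rep c by auto
  qed auto
  have "card {c \<in> C. P c} = (\<Sum>d\<in>{d \<in> C'. Q d}. card {c \<in> C. P c \<and> Z' (f c - d)})"
    unfolding eq
  proof (rule card_UN_disjoint)
    show "\<forall>i\<in>{d \<in> C'. Q d}. \<forall>j\<in>{d \<in> C'. Q d}. i \<noteq> j \<longrightarrow>
      {c \<in> C. P c \<and> Z' (f c - i)} \<inter> {c \<in> C. P c \<and> Z' (f c - j)} = {}"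
      using B.ex1 by blast
  qed (use A.finite B.finite in auto)
  also have "\<dots> = card {d \<in> C'. Q d} * card {c \<in> C. P c \<and> Z' (f c)}"
    using fib by simp
  finally show ?thesis .
qed

text \<open>The map induced by \<open>f\<close> is a self-map of a finite set. It is used to turn
  injectivity of squaring into the existence of square roots, and non-injectivity of a cubic into an
  omitted value.\<close>

lemma transversal_surj_iff_inj:
  assumes "transversal Z C"
    and resp: "\<And>x y. Z (x - y) \<Longrightarrow> Z (f x - f y)"
  shows "(\<forall>y. \<exists>x. Z (f x - y)) \<longleftrightarrow> (\<forall>x y. Z (f x - f y) \<longrightarrow> Z (x - y))"
proof -
  interpret A: transversal Z C by fact
  let ?g = "\<lambda>x. A.rep (f x)"
  have rep_eq: "A.rep x = A.rep y \<longleftrightarrow> Z (x - y)" for x y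
  proof
    assume "A.rep x = A.rep y"
    then show "Z (x - y)" using A.rep(2)[of x] A.cong_trans[OF _ A.cong_sym[OF A.rep(2)[of y]]] by metis
  next
    assume "Z (x - y)"
    then have "Z (A.rep x - A.rep y)"
      using A.cong_trans[OF A.cong_sym[OF A.rep(2)[of x]] A.cong_trans[OF _ A.rep(2)[of y]]] by simp
    then show "A.rep x = A.rep y" using A.rep(1) A.eq_if_cong by blast
  qed
  have rep_C: "A.rep x = x" if "x \<in> C" for x
    using A.eq_if_cong[OF that A.rep(1) A.rep(2)] by simp
  have sub: "?g ` C \<subseteq> C" using A.rep by auto
  have g_rep: "?g (A.rep x) = ?g x" for x
    using rep_eq resp[OF A.cong_sym[OF A.rep(2)]] by blast
  have "(\<forall>y. \<exists>x. Z (f x - y)) \<longleftrightarrow> ?g ` C = C"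
  proof
    assume s: "\<forall>y. \<exists>x. Z (f x - y)"
    have "y \<in> ?g ` C" if y: "y \<in> C" for y
    proof -
      obtain x where "Z (f x - y)" using s by blast
      then have "?g (A.rep x) = y" using rep_eq rep_C[OF y] g_rep by metis
      then show ?thesis using A.rep(1) by blast
    qed
    then show "?g ` C = C" using sub by blast
  next
    assume s: "?g ` C = C"
    show "\<forall>y. \<exists>x. Z (f x - y)"
    proof
      fix y
      obtain x where "?g x = A.rep y" using s A.rep(1) by (metis imageE)
      then show "\<exists>x. Z (f x - y)" using rep_eq by blast
    qed
  qed
  also have "\<dots> \<longleftrightarrow> inj_on ?g C"
    using endo_inj_surj[OF A.finite sub] finite_surj_inj[OF A.finite] by auto
  also have "\<dots> \<longleftrightarrow> (\<forall>x y. Z (f x - f y) \<longrightarrow> Z (x - y))"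
  proof
    assume i: "inj_on ?g C"
    show "\<forall>x y. Z (f x - f y) \<longrightarrow> Z (x - y)"
    proof (intro allI impI)
      fix x y assume "Z (f x - f y)"
      then have "?g (A.rep x) = ?g (A.rep y)" using g_rep rep_eq by metis
      then have "A.rep x = A.rep y" using i A.rep(1) by (meson inj_onD)
      then show "Z (x - y)" using rep_eq by blast
    qed
  next
    assume "\<forall>x y. Z (f x - f y) \<longrightarrow> Z (x - y)"
    then show "inj_on ?g C" using rep_eq A.eq_if_cong by (intro inj_onI) blast
  qed
  finally show ?thesis .
qed

section \<open>Vectors of length 3 modulo an ideal\<close>

type_synonym 'a vec3 = "'a \<times> 'a \<times> 'a"

fun all3 :: "('a \<Rightarrow> bool) \<Rightarrow> 'a vec3 \<Rightarrow> bool" where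
  "all3 P (x, y, z) \<longleftrightarrow> P x \<and> P y \<and> P z"

fun smult3 :: "'a::comm_ring_1 \<Rightarrow> 'a vec3 \<Rightarrow> 'a vec3" where
  "smult3 t (x, y, z) = (t * x, t * y, t * z)"

fun dot3 :: "'a::comm_ring_1 vec3 \<Rightarrow> 'a vec3 \<Rightarrow> 'a" where
  "dot3 (a, b, c) (x, y, z) = a * x + b * y + c * z"

fun cross :: "'a::comm_ring_1 vec3 \<Rightarrow> 'a vec3 \<Rightarrow> 'a vec3" where
  "cross (a, b, c) (x, y, z) = (b * z - c * y, c * x - a * z, a * y - b * x)"

text \<open>Multiplication of \<open>R[\<theta>]/(\<theta>\<^sup>3 + \<theta> + c)\<close> in the basis \<open>1, \<theta>, \<theta>\<^sup>2\<close>.\<close>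

fun mult3 :: "'a::comm_ring_1 \<Rightarrow> 'a vec3 \<Rightarrow> 'a vec3 \<Rightarrow> 'a vec3" where
  "mult3 c (u, v, w) (x, y, z) =
    (u * x - c * (v * z + w * y),
     u * y + v * x - (v * z + w * y) - c * (w * z),
     u * z + v * y + w * x - w * z)"

lemma dot3_commute: "dot3 x y = dot3 y x"
  by (cases x; cases y) (simp add: algebra_simps)

lemma dot3_diff_left: "dot3 (x - y) z = dot3 x z - dot3 y z"
  by (cases x; cases y; cases z) (simp add: algebra_simps)

lemma dot3_smult3_left: "dot3 (smult3 t x) y = t * dot3 x y"
  by (cases x; cases y) (simp add: algebra_simps)

lemma dot3_smult3_right: "dot3 x (smult3 t y) = t * dot3 x y"
  by (cases x; cases y) (simp add: algebra_simps)

lemma dot3_cross_self: "dot3 (cross x y) x = 0" "dot3 (cross x y) y = 0"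
  by (cases x; cases y; simp add: algebra_simps)+

lemma smult3_diff: "smult3 (s - t) x = smult3 s x - smult3 t x"
  by (cases x) (simp add: algebra_simps)

lemma smult3_smult3: "smult3 s (smult3 t x) = smult3 (s * t) x"
  by (cases x) (simp add: algebra_simps)

lemma smult3_one [simp]: "smult3 1 x = x"
  by (cases x) simp

lemma smult3_diff_right: "smult3 t (x - y) = smult3 t x - smult3 t y"
  by (cases x; cases y) (simp add: algebra_simps)

lemma mult3_commute: "mult3 c x y = mult3 c y x"
  by (cases x; cases y) (simp add: algebra_simps)

lemma mult3_assoc: "mult3 c (mult3 c x y) z = mult3 c x (mult3 c y z)"
  by (cases x; cases y; cases z) (simp add: algebra_simps)

lemma mult3_one [simp]: "mult3 c x (1, 0, 0) = x"
  by (cases x) simp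

lemma mult3_diff: "mult3 c x (y - z) = mult3 c x y - mult3 c x z"
  by (cases x; cases y; cases z) (simp add: algebra_simps)

lemma mult3_add: "mult3 c x (y + z) = mult3 c x y + mult3 c x z"
  by (cases x; cases y; cases z) (simp add: algebra_simps)

lemma mult3_smult3_right: "mult3 c x (smult3 s y) = smult3 s (mult3 c x y)"
  by (cases x; cases y) (simp add: algebra_simps)

lemma mult3_smult3: "mult3 c (smult3 s x) (smult3 t y) = smult3 (s * t) (mult3 c x y)"
  by (cases x; cases y) (simp add: algebra_simps)

lemma mult3_scalar: "mult3 c x (t, 0, 0) = smult3 t x"
  by (cases x) (simp add: algebra_simps)

locale ring_ideal =
  fixes I :: "'a::comm_ring_1 \<Rightarrow> bool"
  assumes zero: "I 0"
    and add: "I x \<Longrightarrow> I y \<Longrightarrow> I (x + y)"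
    and mult: "I x \<Longrightarrow> I (a * x)"
begin

lemma mult_right: "I x \<Longrightarrow> I (x * a)"
  using mult[of x a] by (simp add: mult.commute)

lemma uminus: "I x \<Longrightarrow> I (- x)"
  using mult[of x "- 1"] by simp

lemma diff: "I x \<Longrightarrow> I y \<Longrightarrow> I (x - y)"
  using add[of x "- y"] uminus[of y] by simp

lemma comb: "I x \<Longrightarrow> e = a * x \<Longrightarrow> I e"
  by (simp add: mult)

lemma comb2: "I x \<Longrightarrow> I y \<Longrightarrow> e = a * x + b * y \<Longrightarrow> I e"
  by (simp add: mult add)

lemma cong: "I (x - y) \<Longrightarrow> I x \<longleftrightarrow> I y"
  using add[of "x - y" y] diff[of x "x - y"] by auto

lemma vec_zero [simp]: "all3 I 0"
  by (simp add: zero_prod_def zero)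

lemma vec_add: "all3 I x \<Longrightarrow> all3 I y \<Longrightarrow> all3 I (x + y)"
  by (cases x; cases y) (simp add: add)

lemma vec_diff: "all3 I x \<Longrightarrow> all3 I y \<Longrightarrow> all3 I (x - y)"
  by (cases x; cases y) (simp add: diff)

lemma vec_uminus: "all3 I x \<Longrightarrow> all3 I (- x)"
  by (cases x) (simp add: uminus)

lemma vec_smult3: "all3 I x \<Longrightarrow> all3 I (smult3 t x)"
  by (cases x) (simp add: mult)

lemma vec_smult3_scalar: "I t \<Longrightarrow> all3 I (smult3 t x)"
  by (cases x) (simp add: mult_right)

lemma vec_dot3: "all3 I x \<Longrightarrow> I (dot3 x y)"
  by (cases x; cases y) (simp add: mult_right add)

lemma vec_cross: "all3 I x \<Longrightarrow> all3 I (cross x y)"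
  by (cases x; cases y) (simp add: mult mult_right diff)

lemma vec_mult3: "all3 I y \<Longrightarrow> all3 I (mult3 c x y)"
  by (cases x; cases y) (simp add: mult add diff)

lemma vec_cong: "all3 I (x - y) \<Longrightarrow> all3 I x \<longleftrightarrow> all3 I y"
  using vec_add[of "x - y" y] vec_diff[of x "x - y"] by auto

lemma vec_sym: "all3 I (x - y) \<Longrightarrow> all3 I (y - x)"
  using vec_uminus[of "x - y"] by simp

lemma vec_trans: "all3 I (x - y) \<Longrightarrow> all3 I (y - z) \<Longrightarrow> all3 I (x - z)"
  using vec_add[of "x - y" "y - z"] by simp

lemma dot3_cong: "all3 I (x - y) \<Longrightarrow> I (dot3 x z) \<longleftrightarrow> I (dot3 y z)"
  using vec_dot3[of "x - y" z] cong by (simp add: dot3_diff_left)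

text \<open>The dual vector \<open>t\<close> witnesses that \<open>x\<close> is unimodular; pairing
  with \<open>t\<close> recovers the scalar \<open>a\<close> from \<open>smult3 a x\<close>.\<close>

lemma smult3_cancel: "I (dot3 t x - 1) \<Longrightarrow> all3 I (smult3 a x) \<Longrightarrow> I a"
proof -
  assume *: "I (dot3 t x - 1)" "all3 I (smult3 a x)"
  have "I (dot3 (smult3 a x) t)" by (rule vec_dot3) fact
  moreover have "a = - a * (dot3 t x - 1) + 1 * dot3 (smult3 a x) t"
    by (simp add: dot3_smult3_left dot3_commute[of x] algebra_simps)
  ultimately show ?thesis using comb2[OF *(1)] by metis
qed

text \<open>Since \<open>t \<times> (v \<times> w) = (t \<cdot> w) v - (t \<cdot> v) w\<close>.\<close>

lemma parallel_if_cross: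
  assumes "I (dot3 t w - 1)" "all3 I (cross v w)"
  shows "all3 I (v - smult3 (dot3 t v) w)"
proof -
  have "v - smult3 (dot3 t v) w = smult3 (- (dot3 t w - 1)) v - cross (cross v w) t"
    by (cases v; cases w; cases t) (simp add: algebra_simps)
  then show ?thesis
    using vec_diff[OF vec_smult3_scalar vec_cross[OF assms(2)]] uminus[OF assms(1)] by simp
qed

text \<open>Cramer's rule.\<close>

lemma span_if_dot3_cross:
  assumes "I (dot3 t (cross x y) - 1)" "I (dot3 z (cross x y))"
  shows "\<exists>a b. all3 I (z - (smult3 a x + smult3 b y))"
proof -
  have "z - (smult3 (dot3 t (cross z y)) x + smult3 (dot3 t (cross x z)) y) =
      smult3 (- (dot3 t (cross x y) - 1)) z + smult3 (dot3 z (cross x y)) t"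
    by (cases x; cases y; cases z; cases t) (simp add: algebra_simps)
  then show ?thesis
    using vec_add[OF vec_smult3_scalar vec_smult3_scalar, OF uminus[OF assms(1)] assms(2)] by metis
qed

lemma cross_smult3_cong:
  assumes "all3 I (y - smult3 a x)"
  shows "all3 I (cross x y)"
proof -
  have "cross x y = - cross (y - smult3 a x) x"
    by (cases x; cases y) (simp add: algebra_simps)
  then show ?thesis using vec_uminus[OF vec_cross[OF assms]] by simp
qed

lemma cross_sym: "all3 I (cross x y) \<Longrightarrow> all3 I (cross y x)"
proof -
  assume "all3 I (cross x y)"
  moreover have "cross y x = - cross x y"
    by (cases x; cases y) (simp add: algebra_simps)
  ultimately show ?thesis using vec_uminus by metis
qed

lemma mult3_cong: "all3 I (x - y) \<Longrightarrow> all3 I (mult3 c z x - mult3 c z y)"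
  using vec_mult3[of "x - y" c z] by (simp add: mult3_diff)

end

text \<open>The ring \<open>R\<close> is presented as a quotient of the type \<open>'a\<close>: \<open>Z x\<close> says that \<open>x\<close> vanishes in \<open>R\<close>,
  and \<open>C\<close> is a set of representatives. The maximal ideal \<open>2R\<close> is the annihilator \<open>N\<close> of 2.\<close>

locale galois_like =
  fixes Z :: "'a::comm_ring_1 \<Rightarrow> bool" and C :: "'a set"
  assumes tr: "transversal Z C"
    and Z_mult: "Z x \<Longrightarrow> Z (a * x)"
    and Z_4: "Z 4"
    and not_Z_2: "\<not> Z 2"
    and two_dvd: "Z (2 * x) \<Longrightarrow> \<exists>y. Z (x - 2 * y)"
    and unit: "\<not> Z (2 * x) \<Longrightarrow> \<exists>y. Z (x * y - 1)"
begin

definition N :: "'a \<Rightarrow> bool" where "N x \<longleftrightarrow> Z (2 * x)"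

sublocale T: transversal Z C by (rule tr)

sublocale Z: ring_ideal Z
  by unfold_locales (auto intro: T.zero T.add Z_mult)

sublocale N: ring_ideal N
proof
  show "N 0" by (simp add: N_def Z.zero)
  show "N x \<Longrightarrow> N y \<Longrightarrow> N (x + y)" for x y
    unfolding N_def using Z.add[of "2 * x" "2 * y"] by (simp add: algebra_simps)
  show "N x \<Longrightarrow> N (a * x)" for x a
    unfolding N_def using Z.mult[of "2 * x" a] by (simp add: algebra_simps)
qed

lemma N_if_Z: "Z x \<Longrightarrow> N x"
  by (simp add: N_def Z.mult)

lemma N_two_mult: "N (2 * x)"
  unfolding N_def using Z.mult[OF Z_4, of x] by (simp add: algebra_simps)

lemma vec_N_if_Z: "all3 Z x \<Longrightarrow> all3 N x"
  by (cases x) (simp add: N_if_Z)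

lemma not_N_1: "\<not> N 1"
  by (simp add: N_def not_Z_2)

lemma unit_N: "\<not> N x \<Longrightarrow> \<exists>y. Z (x * y - 1)"
  using unit by (simp add: N_def)

text \<open>Everything outside \<open>N\<close> is invertible, so \<open>N\<close> is the maximal
  ideal of a local ring and the residue ring is a field.\<close>

lemma N_prime: "N (x * y) \<Longrightarrow> N x \<or> N y"
proof (rule ccontr)
  assume *: "N (x * y)" "\<not> (N x \<or> N y)"
  then obtain z where "Z (x * z - 1)" using unit_N by blast
  then have "N y" using N.comb2[OF *(1) N_if_Z, of "x * z - 1" y z "- y"] by (simp add: algebra_simps)
  then show False using * by blast
qed

lemma vec_N_iff: "all3 N x \<longleftrightarrow> all3 Z (smult3 2 x)"
  by (cases x) (simp add: N_def)

lemma vec_two: "all3 N x \<Longrightarrow> \<exists>y. all3 Z (x - smult3 2 y)"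
proof (cases x)
  case (fields a b c)
  moreover assume "all3 N x"
  ultimately have "Z (2 * a)" "Z (2 * b)" "Z (2 * c)" by (simp_all add: N_def)
  from this[THEN two_dvd] obtain a' b' c'
    where "Z (a - 2 * a')" "Z (b - 2 * b')" "Z (c - 2 * c')" by auto
  then show ?thesis using fields by (intro exI[of _ "(a', b', c')"]) simp
qed

text \<open>Some coordinate lies outside \<open>N\<close>; its inverse, put in the same position, is
  the required \<open>t\<close>.\<close>

lemma unimod: "\<not> all3 N x \<Longrightarrow> \<exists>t. Z (dot3 t x - 1)"
proof (cases x)
  case (fields a b c)
  assume "\<not> all3 N x"
  then consider "\<not> N a" | "\<not> N b" | "\<not> N c" using fields by auto
  then show ?thesis
  proof cases
    case 1
    then obtain y where "Z (a * y - 1)" using unit_N by blast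
    then show ?thesis using fields by (intro exI[of _ "(y, 0, 0)"]) (simp add: mult.commute)
  next
    case 2
    then obtain y where "Z (b * y - 1)" using unit_N by blast
    then show ?thesis using fields by (intro exI[of _ "(0, y, 0)"]) (simp add: mult.commute)
  next
    case 3
    then obtain y where "Z (c * y - 1)" using unit_N by blast
    then show ?thesis using fields by (intro exI[of _ "(0, 0, y)"]) (simp add: mult.commute)
  qed
qed

lemma smult3_cancel_Z: "\<not> all3 N x \<Longrightarrow> all3 Z (smult3 a x) \<Longrightarrow> Z a"
  using unimod[of x] Z.smult3_cancel[of _ x a] by auto

lemma smult3_cancel_N: "\<not> all3 N x \<Longrightarrow> all3 N (smult3 a x) \<Longrightarrow> N a"
  using unimod[of x] N.smult3_cancel[OF N_if_Z, of _ x a] by auto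

lemma parallel_Z: "\<not> all3 N w \<Longrightarrow> all3 Z (cross v w) \<Longrightarrow> \<exists>a. all3 Z (v - smult3 a w)"
  using unimod[of w] Z.parallel_if_cross[of _ w v] by auto

lemma parallel_N: "\<not> all3 N w \<Longrightarrow> all3 N (cross w v) \<Longrightarrow> \<exists>a. all3 N (v - smult3 a w)"
  using unimod[of w] N.parallel_if_cross[OF N_if_Z N.cross_sym, of _ w v] by auto

text \<open>For unimodular vectors, a cross product vanishing modulo \<open>N\<close> means
  proportionality modulo \<open>N\<close>, and the factors multiply.\<close>

lemma cross_trans:
  assumes "\<not> all3 N x" "\<not> all3 N y" "all3 N (cross x y)" "all3 N (cross y z)"
  shows "all3 N (cross x z)"
proof -
  obtain a b where a: "all3 N (y - smult3 a x)" and b: "all3 N (z - smult3 b y)"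
    using parallel_N[OF assms(1,3)] parallel_N[OF assms(2,4)] by auto
  have "all3 N (z - smult3 (b * a) x)"
    using N.vec_add[OF b N.vec_smult3[OF a, of b]] by (simp add: smult3_diff_right smult3_smult3)
  then show ?thesis by (rule N.cross_smult3_cong)
qed

text \<open>Unimodular \<open>x\<close> and \<open>y\<close> span the same point iff \<open>par x y\<close>; they span neighbouring points iff
  \<open>all3 N (cross x y)\<close>.\<close>

definition par :: "'a vec3 \<Rightarrow> 'a vec3 \<Rightarrow> bool" where
  "par x y \<longleftrightarrow> (\<exists>a. \<not> N a \<and> all3 Z (y - smult3 a x))"

lemma par_if_cong:
  assumes "\<not> all3 N y" "all3 Z (y - smult3 a x)"
  shows "par x y"
proof -
  have "\<not> N a"
    using assms(1) N.vec_cong[OF vec_N_if_Z[OF assms(2)]] N.vec_smult3_scalar[of a x] by auto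
  then show ?thesis using assms(2) par_def by blast
qed

lemma par_sym:
  assumes "par x y" shows "par y x"
proof -
  obtain a where a: "\<not> N a" "all3 Z (y - smult3 a x)" using assms par_def by blast
  obtain b where b: "Z (a * b - 1)" using unit_N a(1) by blast
  have "\<not> N b"
  proof
    assume "N b"
    then have "N 1" using N.comb2[OF _ N_if_Z[OF b], of b 1 a "- 1"] by (simp add: algebra_simps)
    then show False using not_N_1 by blast
  qed
  moreover have "x - smult3 b y = smult3 (- b) (y - smult3 a x) + smult3 (- (a * b - 1)) x"
    by (cases x; cases y) (simp add: algebra_simps)
  then have "all3 Z (x - smult3 b y)"
    using Z.vec_add[OF Z.vec_smult3[OF a(2)] Z.vec_smult3_scalar[OF Z.uminus[OF b]]] by simp
  ultimately show ?thesis using par_def by blast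
qed

lemma par_trans:
  assumes "par x y" "par y z" shows "par x z"
proof -
  obtain a where a: "\<not> N a" "all3 Z (y - smult3 a x)" using assms par_def by blast
  obtain b where b: "\<not> N b" "all3 Z (z - smult3 b y)" using assms par_def by blast
  have "all3 Z (z - smult3 (b * a) x)"
    using Z.vec_add[OF b(2) Z.vec_smult3[OF a(2), of b]]
    by (simp add: smult3_diff_right smult3_smult3)
  then show ?thesis using a(1) b(1) N_prime[of b a] par_def by auto
qed

lemma unimod_par: "par x y \<Longrightarrow> \<not> all3 N x \<Longrightarrow> \<not> all3 N y"
proof -
  assume *: "par x y" "\<not> all3 N x"
  then obtain a where a: "\<not> N a" "all3 Z (y - smult3 a x)" using par_def by auto
  show ?thesis using N.vec_cong[OF vec_N_if_Z[OF a(2)]] smult3_cancel_N[OF *(2), of a] a(1) by auto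
qed

lemma cross_par: "par x y \<Longrightarrow> all3 N (cross x y)"
  unfolding par_def using N.cross_smult3_cong[OF vec_N_if_Z, of y _ x] by metis

lemma dot3_par_imp:
  assumes "par x y" "Z (dot3 x w)" shows "Z (dot3 y w)"
proof -
  obtain a where a: "all3 Z (y - smult3 a x)" using assms(1) par_def by auto
  have "Z (dot3 (smult3 a x) w)" unfolding dot3_smult3_left by (rule Z.mult) fact
  then show ?thesis using Z.dot3_cong[OF a] by blast
qed

lemma dot3_par: "par x y \<Longrightarrow> Z (dot3 x w) \<longleftrightarrow> Z (dot3 y w)"
  by (blast intro: dot3_par_imp par_sym)

end

section \<open>Incidence counts\<close>

lemma transversal_all3:
  assumes "transversal Z C"
  shows "transversal (all3 Z) (C \<times> C \<times> C)"
proof -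
  have "all3 Z = (\<lambda>(x, y). Z x \<and> (\<lambda>(x, y). Z x \<and> Z y) y)"
    by (rule ext) auto
  then show ?thesis using transversal_Times[OF assms transversal_Times[OF assms assms]] by metis
qed

lemma sum_card_swap:
  assumes "finite A" "finite B"
  shows "(\<Sum>a\<in>A. card {b \<in> B. r a b}) = (\<Sum>b\<in>B. card {a \<in> A. r a b})"
proof -
  have "(\<Sum>a\<in>A. card {b \<in> B. r a b}) = (\<Sum>a\<in>A. \<Sum>b\<in>B. if r a b then 1 else 0)"
    using assms by (simp flip: sum.inter_filter)
  also have "\<dots> = (\<Sum>b\<in>B. \<Sum>a\<in>A. if r a b then 1 else 0)" by (rule sum.swap)
  also have "\<dots> = (\<Sum>b\<in>B. card {a \<in> A. r a b})"
    using assms by (simp flip: sum.inter_filter)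
  finally show ?thesis .
qed

lemma card_filter_not:
  "finite A \<Longrightarrow> card {x \<in> A. P x} + card {x \<in> A. \<not> P x} = card A"
  by (subst card_Un_disjoint[symmetric]) (auto intro!: arg_cong[of _ _ card])

context galois_like
begin

text \<open>The order of the residue field is read off from the maximal ideal, which has as many
  elements. As \<open>m\<close> counts the units, each point and each line has exactly
  \<open>m\<close> coordinate vectors in \<open>U3\<close>, and the counts of vectors below carry
  the corresponding factors \<open>m\<close>.\<close>

definition q :: nat where "q = card {c \<in> C. N c}"

definition m :: nat where "m = card {c \<in> C. \<not> N c}"

definition C3 :: "'a vec3 set" where "C3 = C \<times> C \<times> C"

definition U3 :: "'a vec3 set" where "U3 = {x \<in> C3. \<not> all3 N x}"

text \<open>A line is represented by the unimodular vector of its equation, so \<open>W x\<close>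
  consists of the vectors of all lines through the point of \<open>x\<close>.\<close>

definition W :: "'a vec3 \<Rightarrow> 'a vec3 set" where "W x = {w \<in> U3. Z (dot3 w x)}"

lemma tr3: "transversal (all3 Z) C3"
  unfolding C3_def by (rule transversal_all3) (rule tr)

sublocale T3: transversal "all3 Z" C3 by (rule tr3)

lemma finite_U3 [simp]: "finite U3" and finite_W [simp]: "finite (W x)"
  by (auto simp: U3_def W_def T3.finite)

lemma N_cong: "N x \<Longrightarrow> Z (x - y) \<Longrightarrow> N y"
  using N.cong[OF N_if_Z] by blast

lemma vec_N_cong: "all3 Z (x - y) \<Longrightarrow> all3 N x \<longleftrightarrow> all3 N y"
  by (rule N.vec_cong[OF vec_N_if_Z])

text \<open>Multiplication by 2 maps \<open>R\<close> onto \<open>N\<close>, and its kernel is again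
  \<open>N\<close>.\<close>

lemma card_C: "card C = q\<^sup>2"
proof -
  have "card {c \<in> C. True} = card {c \<in> C. N c} * card {c \<in> C. True \<and> Z (2 * c)}"
  proof (rule card_transversal_fibres[OF tr tr])
    show "\<exists>x. True \<and> Z (2 * x - y)" if "N y" for y
      using two_dvd[of y] that Z.uminus unfolding N_def by (metis minus_diff_eq)
  qed (auto simp: right_diff_distrib Z.mult N_two_mult intro: N_cong)
  then show ?thesis by (simp add: q_def N_def power2_eq_square)
qed

lemma m_plus_q: "m + q = q\<^sup>2"
  using card_filter_not[OF T.finite, of N] by (simp add: m_def q_def card_C add.commute)

lemma card_C3: "card C3 = q ^ 6"
  by (simp add: C3_def card_cartesian_product card_C)

lemma card_N3: "card {x \<in> C3. all3 N x} = q ^ 3"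
proof -
  have "{x \<in> C3. all3 N x} = {c \<in> C. N c} \<times> {c \<in> C. N c} \<times> {c \<in> C. N c}"
    by (auto simp: C3_def)
  then show ?thesis by (simp add: card_cartesian_product q_def power3_eq_cube mult.assoc)
qed

lemma card_U3: "card U3 + q ^ 3 = q ^ 6"
  using card_filter_not[OF T3.finite, of "all3 N"] by (simp add: U3_def card_N3 card_C3 add.commute)

lemma q_pos: "q > 0"
proof -
  have "Z (0 - T.rep 0)" by (rule T.rep)
  then have "N (T.rep 0)" using N_if_Z T.uminus[of "0 - T.rep 0"] by simp
  then have "T.rep 0 \<in> {c \<in> C. N c}" using T.rep by simp
  then show ?thesis unfolding q_def using T.finite by (simp add: card_gt_0_iff) blast
qed

lemma m_pos: "m > 0"
proof -
  have "\<not> N (T.rep 1)" using T.rep(2)[of 1] N.cong[OF N_if_Z] not_N_1 by blast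
  then have "T.rep 1 \<in> {c \<in> C. \<not> N c}" using T.rep by simp
  then show ?thesis unfolding m_def using T.finite by (simp add: card_gt_0_iff) blast
qed

lemma m_eq: "int m = int q ^ 2 - int q"
  using arg_cong[OF m_plus_q, of int] by simp

lemma q_gt_1: "q > 1"
  using m_plus_q m_pos q_pos by (cases "q = 1") auto

text \<open>Pairing with a unimodular vector is a homomorphism from \<open>R^3\<close> onto
  \<open>R\<close>; the multiples of the dual vector \<open>t\<close> already reach every
  value.\<close>

lemma card_perp:
  assumes "\<not> all3 N x"
  shows "card {v \<in> C3. Z (dot3 v x)} = q ^ 4"
proof -
  obtain t where t: "Z (dot3 t x - 1)" using unimod assms by blast
  have "card {c \<in> C3. True} = card {c \<in> C. True} * card {c \<in> C3. True \<and> Z (dot3 c x)}"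
  proof (rule card_transversal_fibres[OF tr3 tr])
    fix y
    have "dot3 (smult3 y t) x - y = y * (dot3 t x - 1)" by (simp add: dot3_smult3_left algebra_simps)
    then show "\<exists>v. True \<and> Z (dot3 v x - y)" using Z.mult[OF t, of y] by metis
  qed (auto simp: dot3_diff_left Z.vec_dot3)
  then have "q\<^sup>2 * q ^ 4 = q\<^sup>2 * card {c \<in> C3. Z (dot3 c x)}"
    by (simp add: card_C card_C3 flip: power_add)
  then show ?thesis using q_pos by (simp del: power_add_numeral)
qed

lemma card_perp_N:
  assumes "\<not> all3 N x"
  shows "card {v \<in> C3. all3 N v \<and> Z (dot3 v x)} = q\<^sup>2"
proof -
  obtain t where t: "Z (dot3 t x - 1)" using unimod assms by blast
  have "card {c \<in> C3. all3 N c} = card {c \<in> C. N c} * card {c \<in> C3. all3 N c \<and> Z (dot3 c x)}"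
  proof (rule card_transversal_fibres[OF tr3 tr])
    fix y assume y: "N y"
    have "dot3 (smult3 y t) x - y = y * (dot3 t x - 1)" by (simp add: dot3_smult3_left algebra_simps)
    then show "\<exists>v. all3 N v \<and> Z (dot3 v x - y)"
      using Z.mult[OF t, of y] N.vec_smult3_scalar[OF y] by metis
  qed (auto simp: dot3_diff_left Z.vec_dot3 N.vec_dot3 N.vec_diff vec_N_cong intro: N_cong)
  then have "q * q\<^sup>2 = q * card {c \<in> C3. all3 N c \<and> Z (dot3 c x)}"
    using card_N3 unfolding q_def[symmetric] by (auto simp: power3_eq_cube power2_eq_square)
  then show ?thesis using q_pos by simp
qed

text \<open>From the \<open>q^4\<close> vectors orthogonal to \<open>x\<close> the
  \<open>q^2\<close> non-unimodular ones are removed, and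
  \<open>q^4 - q^2 = m (q^2 + q)\<close>.\<close>

lemma card_W:
  assumes "\<not> all3 N x"
  shows "int (card (W x)) = int m * (int q ^ 2 + int q)"
proof -
  have "card {v \<in> {v \<in> C3. Z (dot3 v x)}. all3 N v} + card {v \<in> {v \<in> C3. Z (dot3 v x)}. \<not> all3 N v}
    = card {v \<in> C3. Z (dot3 v x)}"
    by (rule card_filter_not) (simp add: T3.finite)
  moreover have "{v \<in> {v \<in> C3. Z (dot3 v x)}. all3 N v} = {v \<in> C3. all3 N v \<and> Z (dot3 v x)}" by auto
  moreover have "{v \<in> {v \<in> C3. Z (dot3 v x)}. \<not> all3 N v} = W x" by (auto simp: W_def U3_def)
  ultimately have "q\<^sup>2 + card (W x) = q ^ 4"
    using card_perp[OF assms] card_perp_N[OF assms] by simp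
  from arg_cong[OF this, of int] have "int q ^ 2 + int (card (W x)) = int q ^ 4"
    by simp
  then show ?thesis by (simp add: m_eq algebra_simps power2_eq_square power4_eq_xxxx)
qed

lemma card_par:
  assumes "\<not> all3 N x"
  shows "card {y \<in> U3. par x y} = m"
proof -
  have "card {c \<in> C. \<not> N c} = card {y \<in> C3. par x y}"
  proof (rule card_transversal_eq[OF tr tr3, where f = "\<lambda>a. smult3 a x"])
    show "\<not> N y" if "\<not> N a" "Z (a - y)" for a y using that N_cong T.cong_sym by blast
    show "par x z" if "par x y" "all3 Z (y - z)" for y z
      using that Z.vec_trans[OF Z.vec_sym[OF that(2)]] unfolding par_def by blast
    show "par x (smult3 a x)" if "\<not> N a" for a
      unfolding par_def using that by (intro exI[of _ a]) simp
    show "all3 Z (smult3 a x - smult3 b x)" if "Z (a - b)" for a b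
      using Z.vec_smult3_scalar[OF that] by (simp add: smult3_diff)
    show "Z (a - b)" if "all3 Z (smult3 a x - smult3 b x)" for a b
      using that smult3_cancel_Z[OF assms] by (simp flip: smult3_diff)
    show "\<exists>a. \<not> N a \<and> all3 Z (smult3 a x - y)" if "par x y" for y
      using that Z.vec_sym unfolding par_def by blast
  qed
  moreover have "{y \<in> C3. par x y} = {y \<in> U3. par x y}"
    unfolding U3_def using unimod_par[OF _ assms] by blast
  ultimately show ?thesis by (simp add: m_def)
qed

lemma card_W_Int_par:
  assumes "\<not> all3 N x" "par x y"
  shows "int (card {w \<in> W x. Z (dot3 w y)}) = int m * (int q ^ 2 + int q)"
proof -
  have "{w \<in> W x. Z (dot3 w y)} = W x"
    unfolding W_def using dot3_par[OF assms(2)] by (auto simp: dot3_commute)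
  then show ?thesis using card_W[OF assms(1)] by simp
qed

text \<open>Two points that are not neighbours lie on exactly one common line, whose equation is
  given by the cross product.\<close>

lemma card_W_Int_cross:
  assumes "\<not> all3 N (cross x y)"
  shows "card {w \<in> W x. Z (dot3 w y)} = m"
proof -
  have "par (cross x y) w \<longleftrightarrow> Z (dot3 w x) \<and> Z (dot3 w y)" if "w \<in> U3" for w
  proof
    assume "par (cross x y) w"
    then show "Z (dot3 w x) \<and> Z (dot3 w y)"
      using dot3_par dot3_cross_self Z.zero by metis
  next
    assume *: "Z (dot3 w x) \<and> Z (dot3 w y)"
    have "cross w (cross x y) = smult3 (dot3 w y) x - smult3 (dot3 w x) y"
      by (cases w; cases x; cases y) (simp add: algebra_simps)
    then have "all3 Z (cross w (cross x y))"
      using * by (simp add: Z.vec_diff Z.vec_smult3_scalar)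
    then obtain a where "all3 Z (w - smult3 a (cross x y))" using parallel_Z[OF assms] by blast
    then show "par (cross x y) w" using par_if_cong that by (simp add: U3_def)
  qed
  then have "{w \<in> W x. Z (dot3 w y)} = {w \<in> U3. par (cross x y) w}" by (auto simp: W_def)
  then show ?thesis using card_par[OF assms] by simp
qed

text \<open>Here \<open>y = a x + 2 z\<close>, where \<open>x\<close> and \<open>z\<close> are
  independent modulo \<open>N\<close>. If \<open>w\<close> is orthogonal to \<open>x\<close>, it is
  orthogonal to \<open>y\<close> iff \<open>dot3 w z\<close> lies in \<open>N\<close>, that is, iff
  \<open>w\<close> lies in the kernel of a map from the orthogonal space of \<open>x\<close> onto
  \<open>2R\<close>. This kernel has \<open>q^3\<close> elements, of which \<open>q^2\<close> are
  not unimodular.\<close>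

lemma card_W_Int_neighbour:
  assumes x: "\<not> all3 N x" and y: "\<not> all3 N y" and xy: "all3 N (cross x y)" and np: "\<not> par x y"
  shows "int (card {w \<in> W x. Z (dot3 w y)}) = int m * int q"
proof -
  obtain a where a: "all3 N (y - smult3 a x)" using parallel_N[OF x xy] by blast
  obtain z where z: "all3 Z (y - smult3 a x - smult3 2 z)" using vec_two[OF a] by blast
  have xz: "\<not> all3 N (cross x z)"
  proof
    assume "all3 N (cross x z)"
    then obtain b where b: "all3 N (z - smult3 b x)" using parallel_N[OF x] by blast
    \<comment> \<open>If \<open>z\<close> were proportional to \<open>x\<close> modulo
      \<open>N\<close>, then \<open>2 z\<close> would be a multiple of \<open>2 x\<close> in
      \<open>R\<close>, and \<open>y\<close> would span the same point as \<open>x\<close>.\<close>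
    have "y - smult3 (a + 2 * b) x = (y - smult3 a x - smult3 2 z) + smult3 2 (z - smult3 b x)"
      by (cases x; cases y; cases z) (simp add: algebra_simps)
    then have "all3 Z (y - smult3 (a + 2 * b) x)"
      using Z.vec_add[OF z] b unfolding vec_N_iff by metis
    then show False using par_if_cong[OF y] np by blast
  qed
  obtain t where t: "Z (dot3 t (cross x z) - 1)" using unimod xz by blast
  have iff: "Z (dot3 w y) \<longleftrightarrow> N (dot3 w z)" if "Z (dot3 w x)" for w
  proof -
    have "dot3 w y = dot3 (y - smult3 a x - smult3 2 z) w + a * dot3 w x + 2 * dot3 w z"
      by (cases w; cases x; cases y; cases z) (simp add: algebra_simps)
    then have "Z (dot3 w y - 2 * dot3 w z)"
      using Z.add[OF Z.vec_dot3[OF z] Z.mult[OF that]] by simp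
    then show ?thesis unfolding N_def by (rule Z.cong)
  qed
  have "card {v \<in> C3. Z (dot3 v x)} =
    card {c \<in> C. N c} * card {v \<in> C3. Z (dot3 v x) \<and> Z (2 * dot3 v z)}"
  proof (rule card_transversal_fibres[OF tr3 tr])
    fix s assume "N s"
    then obtain s' where s': "Z (s - 2 * s')" using two_dvd N_def by blast
    \<comment> \<open>The preimage of \<open>s = 2 s'\<close> is \<open>s'\<close> times
      \<open>cross t x\<close>: this is orthogonal to \<open>x\<close>, and its product with
      \<open>z\<close> is the triple product of \<open>t\<close>, \<open>x\<close>,
      \<open>z\<close>, which is 1 by the choice of \<open>t\<close>.\<close>
    have "dot3 (smult3 s' (cross t x)) x = 0"
      by (simp add: dot3_smult3_left dot3_cross_self)
    moreover have "2 * dot3 (smult3 s' (cross t x)) z - s =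
        2 * s' * (dot3 t (cross x z) - 1) + (- 1) * (s - 2 * s')"
      by (cases t; cases x; cases z) (simp add: algebra_simps)
    ultimately show "\<exists>v. Z (dot3 v x) \<and> Z (2 * dot3 v z - s)"
      using Z.comb2[OF t s'] Z.zero by metis
  next
    show "Z (dot3 v x)" if "Z (dot3 u x)" "all3 Z (u - v)" for u v
      using that Z.dot3_cong by blast
  qed (auto simp: dot3_diff_left right_diff_distrib Z.vec_dot3 Z.diff Z.mult N_two_mult intro: N_cong)
  then have "q * q ^ 3 = q * card {v \<in> C3. Z (dot3 v x) \<and> Z (2 * dot3 v z)}"
    using card_perp[OF x] by (simp add: q_def flip: power_Suc)
  then have "card {v \<in> C3. Z (dot3 v x) \<and> N (dot3 v z)} = q ^ 3"
    using q_pos by (simp add: N_def)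
  moreover have "card {v \<in> {v \<in> C3. Z (dot3 v x) \<and> N (dot3 v z)}. all3 N v}
    + card {v \<in> {v \<in> C3. Z (dot3 v x) \<and> N (dot3 v z)}. \<not> all3 N v}
    = card {v \<in> C3. Z (dot3 v x) \<and> N (dot3 v z)}"
    by (rule card_filter_not) (simp add: T3.finite)
  moreover have "{v \<in> {v \<in> C3. Z (dot3 v x) \<and> N (dot3 v z)}. all3 N v}
    = {v \<in> C3. all3 N v \<and> Z (dot3 v x)}" using N.vec_dot3 by blast
  moreover have "{v \<in> {v \<in> C3. Z (dot3 v x) \<and> N (dot3 v z)}. \<not> all3 N v} = {w \<in> W x. Z (dot3 w y)}"
    using iff by (auto simp: W_def U3_def)
  ultimately have "q\<^sup>2 + card {w \<in> W x. Z (dot3 w y)} = q ^ 3"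
    using card_perp_N[OF x] by simp
  from arg_cong[OF this, of int] have "int q ^ 2 + int (card {w \<in> W x. Z (dot3 w y)}) = int q ^ 3"
    by simp
  then show ?thesis by (simp add: m_eq algebra_simps power2_eq_square power3_eq_cube)
qed

text \<open>Double counting of the lines joining \<open>p\<close> to the elements of
  \<open>X\<close>. The number of such line vectors is \<open>m (q^2 + q)\<close> for the same
  point, \<open>m q\<close> for a proper neighbour and \<open>m\<close> otherwise. Since equal
  points are also neighbours, the three weights are \<open>q^2\<close>, \<open>q - 1\<close> and
  \<open>1\<close>.\<close>

lemma sum_card_W:
  assumes p: "\<not> all3 N p" and X: "X \<subseteq> U3"
  shows "(\<Sum>w\<in>W p. int (card {x \<in> X. Z (dot3 w x)})) =
    int m * (int (card {x \<in> X. par p x}) * int q ^ 2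
      + int (card {x \<in> X. all3 N (cross p x)}) * (int q - 1) + int (card X))"
proof -
  have finX: "finite X" using X finite_U3 finite_subset by blast
  have eq: "int (card {w \<in> W p. Z (dot3 w x)}) =
      (if par p x then int m * int q ^ 2 else 0)
      + (if all3 N (cross p x) then int m * (int q - 1) else 0) + int m" if "x \<in> X" for x
  proof -
    have x: "\<not> all3 N x" using that X by (auto simp: U3_def)
    show ?thesis
      using card_W_Int_par[OF p, of x] card_W_Int_cross[of p x] card_W_Int_neighbour[OF p x]
        cross_par[of p x] by (auto simp: algebra_simps)
  qed
  have "(\<Sum>w\<in>W p. int (card {x \<in> X. Z (dot3 w x)})) =
      (\<Sum>x\<in>X. int (card {w \<in> W p. Z (dot3 w x)}))"
    using sum_card_swap[of "W p" X "\<lambda>w x. Z (dot3 w x)"] finX by (simp flip: of_nat_sum)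
  also have "\<dots> = (\<Sum>x\<in>X. (if par p x then int m * int q ^ 2 else 0)
      + (if all3 N (cross p x) then int m * (int q - 1) else 0) + int m)"
    using eq by simp
  also have "\<dots> = int (card {x \<in> X. par p x}) * (int m * int q ^ 2)
      + int (card {x \<in> X. all3 N (cross p x)}) * (int m * (int q - 1)) + int (card X) * int m"
    using finX by (simp add: sum.distrib flip: sum.inter_filter)
  finally show ?thesis by (simp add: algebra_simps)
qed

lemma card_U3_eq: "int (card U3) = int m * int q ^ 2 * (int q ^ 2 + int q + 1)"
proof -
  have "int (card U3) + int q ^ 3 = int q ^ 6" using arg_cong[OF card_U3, of int] by simp
  then show ?thesis unfolding m_eq by Groebner_Basis.algebra
qed

text \<open>Taking all of \<open>U3\<close> for \<open>X\<close> in \<open>sum_card_W\<close> makes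
  every other term known, because each line carries \<open>m (q^2 + q)\<close> vectors; the equation
  is then solved for the size of the neighbour class.\<close>

lemma card_neighbours:
  assumes p: "\<not> all3 N p"
  shows "int (card {x \<in> U3. all3 N (cross p x)}) = int m * int q ^ 2"
proof -
  let ?b = "int (card {x \<in> U3. all3 N (cross p x)})" and ?q = "int q" and ?m = "int m"
  have "int (card {x \<in> U3. Z (dot3 w x)}) = ?m * (?q ^ 2 + ?q)" if "w \<in> W p" for w
  proof -
    have "{x \<in> U3. Z (dot3 w x)} = W w" by (auto simp: W_def dot3_commute)
    moreover have "\<not> all3 N w" using that by (auto simp: W_def U3_def)
    ultimately show ?thesis using card_W by simp
  qed
  then have "?m * (?q ^ 2 + ?q) * (?m * (?q ^ 2 + ?q)) =
    ?m * (?m * ?q ^ 2 + ?b * (?q - 1) + ?m * ?q ^ 2 * (?q ^ 2 + ?q + 1))"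
    using sum_card_W[OF p subset_refl] card_par[OF p] card_W[OF p] card_U3_eq by simp
  then have "(?q ^ 2 + ?q) * (?m * (?q ^ 2 + ?q)) =
    ?m * ?q ^ 2 + ?b * (?q - 1) + ?m * ?q ^ 2 * (?q ^ 2 + ?q + 1)"
    using m_pos by (simp add: mult.assoc)
  then have "(?q - 1) * ?b = (?q - 1) * (?m * ?q ^ 2)"
    by Groebner_Basis.algebra
  then show ?thesis using q_gt_1 by simp
qed

end

section \<open>Upper bound for arcs\<close>

context galois_like
begin

lemma arc_upper_bound:
  assumes K: "K \<subseteq> U3"
    and closed: "\<And>x y. x \<in> K \<Longrightarrow> y \<in> U3 \<Longrightarrow> par x y \<Longrightarrow> y \<in> K"
    and lines: "\<And>w. w \<in> U3 \<Longrightarrow> 2 * int (card {x \<in> K. Z (dot3 w x)}) \<le> int m * int q ^ 2"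
  shows "2 * int (card K) \<le> int m * (int q ^ 4 - int q)"
proof -
  let ?u = "\<lambda>p. int (card {x \<in> K. all3 N (cross p x)})" and ?q = "int q" and ?m = "int m"
  have finK: "finite K" using K finite_U3 finite_subset by blast
  have m0: "0 < ?m" and q0: "1 < ?q" using m_pos q_gt_1 by auto
  show ?thesis
  proof (cases "\<exists>p\<in>K. ?m * (?q ^ 2 - ?q) \<le> 2 * ?u p")
    \<comment> \<open>The threshold is \<open>(q^2 - q)/2\<close> points in one neighbour class,
      counted as vectors; there the two estimates agree. In this case the lines through
      \<open>p\<close> are counted.\<close>
    case True
    then obtain p where p: "p \<in> K" and u: "?m * (?q ^ 2 - ?q) \<le> 2 * ?u p" by blast
    have up: "\<not> all3 N p" using p K by (auto simp: U3_def)
    have "{x \<in> K. par p x} = {x \<in> U3. par p x}" using closed[OF p] K by blast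
    then have "2 * (?m * (?m * ?q ^ 2 + ?u p * (?q - 1) + int (card K))) =
        2 * (\<Sum>w\<in>W p. int (card {x \<in> K. Z (dot3 w x)}))"
      using sum_card_W[OF up K] card_par[OF up] by simp
    also have "\<dots> = (\<Sum>w\<in>W p. 2 * int (card {x \<in> K. Z (dot3 w x)}))"
      by (simp add: sum_distrib_left)
    also have "\<dots> \<le> (\<Sum>w\<in>W p. ?m * ?q ^ 2)"
      by (rule sum_mono) (auto simp: W_def intro: lines)
    also have "\<dots> = ?m * (?q ^ 2 + ?q) * (?m * ?q ^ 2)" using card_W[OF up] by simp
    finally have "?m * (2 * (?m * ?q ^ 2 + ?u p * (?q - 1) + int (card K))) \<le>
      ?m * ((?q ^ 2 + ?q) * (?m * ?q ^ 2))" by (simp add: algebra_simps)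
    then have "2 * (?m * ?q ^ 2 + ?u p * (?q - 1) + int (card K)) \<le> (?q ^ 2 + ?q) * (?m * ?q ^ 2)"
      using m0 by simp
    moreover have "(?q - 1) * (?m * (?q ^ 2 - ?q)) \<le> (?q - 1) * (2 * ?u p)"
      using u q0 by (intro mult_left_mono) auto
    ultimately have "2 * int (card K) \<le>
        (?q ^ 2 + ?q) * (?m * ?q ^ 2) - 2 * (?m * ?q ^ 2) - (?q - 1) * (?m * (?q ^ 2 - ?q))"
      by (simp add: algebra_simps)
    also have "\<dots> = ?m * (?q ^ 4 - ?q)" by Groebner_Basis.algebra
    finally show ?thesis .
  next
    case False
    \<comment> \<open>The failed case distinction speaks only of \<open>p\<close> in
      \<open>K\<close>. A class that meets \<open>K\<close> in \<open>y\<close> is contained in the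
      class of \<open>y\<close>, and a class that misses \<open>K\<close> contributes
      nothing.\<close>
    have bound: "2 * ?u p \<le> ?m * (?q ^ 2 - ?q)" if p: "p \<in> U3" for p
    proof (cases "{x \<in> K. all3 N (cross p x)} = {}")
      case True
      have "0 \<le> ?q * (?q - 1)" using q0 by simp
      then have "0 \<le> ?q ^ 2 - ?q" by (simp add: algebra_simps power2_eq_square)
      then show ?thesis unfolding True using m0 by simp
    next
      case nonempty: False
      then obtain y where y: "y \<in> K" "all3 N (cross p y)" by blast
      have un: "\<not> all3 N p" "\<not> all3 N y" using p y K by (auto simp: U3_def)
      have "{x \<in> K. all3 N (cross p x)} \<subseteq> {x \<in> K. all3 N (cross y x)}"
        using cross_trans[OF un(2,1) N.cross_sym[OF y(2)]] by blast
      then have "?u p \<le> ?u y" using finK by (simp only: of_nat_le_iff) (rule card_mono, auto)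
      then show ?thesis using False y(1) by fastforce
    qed
    \<comment> \<open>Each vector of \<open>K\<close> is a neighbour of exactly \<open>m q^2\<close>
      vectors of \<open>U3\<close>, so summing the class sizes over \<open>U3\<close> counts it that
      often.\<close>
    have "int (card K) * (?m * ?q ^ 2) = (\<Sum>x\<in>K. int (card {p \<in> U3. all3 N (cross p x)}))"
    proof -
      have "int (card {p \<in> U3. all3 N (cross p x)}) = ?m * ?q ^ 2" if "x \<in> K" for x
      proof -
        have "\<not> all3 N x" using that K by (auto simp: U3_def)
        moreover have "{p \<in> U3. all3 N (cross p x)} = {p \<in> U3. all3 N (cross x p)}"
          by (rule Collect_cong) (metis N.cross_sym)
        ultimately show ?thesis using card_neighbours by simp
      qed
      then show ?thesis by simp
    qed
    also have "\<dots> = (\<Sum>p\<in>U3. ?u p)"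
      using sum_card_swap[of U3 K "\<lambda>p x. all3 N (cross p x)"] finK by (simp flip: of_nat_sum)
    finally have "2 * (int (card K) * (?m * ?q ^ 2)) = (\<Sum>p\<in>U3. 2 * ?u p)"
      by (simp add: sum_distrib_left)
    also have "\<dots> \<le> (\<Sum>p\<in>U3. ?m * (?q ^ 2 - ?q))"
      by (rule sum_mono) (rule bound)
    also have "\<dots> = ?m * ?q ^ 2 * (?q ^ 2 + ?q + 1) * (?m * (?q ^ 2 - ?q))" using card_U3_eq by simp
    also have "\<dots> = (?m * ?q ^ 2) * (?m * (?q ^ 4 - ?q))" by Groebner_Basis.algebra
    finally have "(?m * ?q ^ 2) * (2 * int (card K)) \<le> (?m * ?q ^ 2) * (?m * (?q ^ 4 - ?q))"
      by (simp add: algebra_simps)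
    moreover have "0 < ?m * ?q ^ 2" using m0 q0 by simp
    ultimately show ?thesis by (simp add: mult_le_cancel_left_pos)
  qed
qed

section \<open>Roots over the residue field\<close>

lemma ex_transversal_N: "\<exists>D. transversal N D"
proof -
  \<comment> \<open>The choice depends only on the class of \<open>x\<close> modulo
    \<open>N\<close>, and choosing inside \<open>C\<close> keeps the range finite.\<close>
  define g where "g x = (SOME c. c \<in> C \<and> N (x - c))" for x
  have g: "g x \<in> C \<and> N (x - g x)" for x
    unfolding g_def by (rule someI_ex) (use T.rep N_if_Z in blast)
  have g_eq: "g x = g y" if "N (x - y)" for x y
  proof -
    have "N (x - c) \<longleftrightarrow> N (y - c)" for c
      using N.cong[of "x - c" "y - c"] that by simp
    then show ?thesis by (simp add: g_def)
  qed
  have "transversal N (range g)"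
  proof
    show "finite (range g)" using g T.finite by (meson finite_subset image_subsetI)
    fix x
    show "\<exists>!c. c \<in> range g \<and> N (x - c)"
    proof (rule ex1I[of _ "g x"])
      fix c assume "c \<in> range g \<and> N (x - c)"
      then obtain y where y: "c = g y" "N (x - g y)" by blast
      have "N (x - y)" using N.diff[OF y(2), of "y - g y"] g by simp
      then show "c = g x" using g_eq y by simp
    qed (use g in auto)
  qed (auto intro: N.zero N.diff)
  then show ?thesis by blast
qed

text \<open>In characteristic 2 the map \<open>t \<mapsto> t\<^sup>3 + t\<close> identifies 0 and 1, so it is not onto.\<close>

lemma ex_no_root: "\<exists>c. \<forall>t. \<not> N (t ^ 3 + t + c)"
proof (rule ccontr)
  assume neg: "\<not> ?thesis"
  obtain D where D: "transversal N D" using ex_transversal_N by blast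
  have "(\<forall>y. \<exists>x. N (x ^ 3 + x - y)) \<longleftrightarrow> (\<forall>x y. N (x ^ 3 + x - (y ^ 3 + y)) \<longrightarrow> N (x - y))"
  proof (rule transversal_surj_iff_inj[OF D])
    fix x y assume "N (x - y)"
    then show "N (x ^ 3 + x - (y ^ 3 + y))"
      by (rule N.comb[of _ _ "x ^ 2 + x * y + y ^ 2 + 1"])
        (simp add: algebra_simps power3_eq_cube power2_eq_square)
  qed
  moreover have "\<exists>x. N (x ^ 3 + x - y)" for y
    using neg by (metis add_uminus_conv_diff)
  ultimately have "N (1 ^ 3 + 1 - (0 ^ 3 + 0)) \<longrightarrow> N (1 - 0)" by blast
  then show False using not_N_1 N_two_mult[of 1] by simp
qed

text \<open>Squaring is additive in characteristic 2 and has trivial kernel, so it is a bijection of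
  the finite residue field.\<close>

lemma ex_sqrt: "\<exists>x. N (x * x - y)"
proof -
  obtain D where D: "transversal N D" using ex_transversal_N by blast
  have "(\<forall>y. \<exists>x. N (x * x - y)) \<longleftrightarrow> (\<forall>x y. N (x * x - y * y) \<longrightarrow> N (x - y))"
  proof (rule transversal_surj_iff_inj[OF D])
    fix x y assume "N (x - y)"
    then show "N (x * x - y * y)" by (rule N.comb[of _ _ "x + y"]) (simp add: algebra_simps)
  qed
  moreover have "N (x - y)" if "N (x * x - y * y)" for x y
  proof -
    have "N ((x - y) * (x - y))"
      by (rule N.comb2[OF that N_two_mult[of "y * y - x * y"], of _ 1 1]) (simp add: algebra_simps)
    then show ?thesis using N_prime by blast
  qed
  ultimately show ?thesis by blast
qed

end

section \<open>The hyperoval of squares\<close>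

text \<open>A cubic without a root in the residue field is irreducible, so modulo \<open>N\<close>
  the triples under \<open>mult3 c\<close> form the cubic extension field. The lemmas up to
  \<open>ex_inverse\<close> construct its inverses explicitly.\<close>

locale galois_cubic = galois_like +
  fixes c :: 'a
  assumes no_root: "\<not> N (t ^ 3 + t + c)"
begin

abbreviation mul :: "'a vec3 \<Rightarrow> 'a vec3 \<Rightarrow> 'a vec3" where "mul \<equiv> mult3 c"

definition sq :: "'a vec3 \<Rightarrow> 'a vec3" where "sq u = mult3 c u u"

lemma mul_left_commute: "mul x (mul y z) = mul y (mul x z)"
  by (metis mult3_assoc mult3_commute)

lemmas mul_ac = mult3_assoc mult3_commute mul_left_commute

text \<open>If \<open>b\<close> is a unit, then \<open>a + b \<theta>\<close> is
  \<open>b (\<theta> - t)\<close> modulo \<open>N\<close> with \<open>t = - a / b\<close>. Dividing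
  the cubic by \<open>\<theta> - t\<close> leaves the quotient
  \<open>\<theta>^2 + t \<theta> + t^2 + 1\<close> and the remainder \<open>e = t^3 + t + c\<close>,
  which is a unit as \<open>t\<close> is not a root. Hence the inverse is this quotient times
  \<open>s = - 1 / (b e)\<close>.\<close>

lemma inverse_linear:
  assumes "\<not> (N a \<and> N b)"
  shows "\<exists>v. all3 N (mul (a, b, 0) v - (1, 0, 0))"
proof (cases "N b")
  case True
  then obtain y where "Z (a * y - 1)" using assms unit_N by blast
  then show ?thesis using True
    by (intro exI[of _ "(y, 0, 0)"]) (simp add: N_if_Z N.mult_right N.zero)
next
  case False
  then obtain y where "Z (b * y - 1)" using unit_N by blast
  then have d: "N (b * y - 1)" by (rule N_if_Z)
  define t where "t = - a * y"
  define e where "e = t ^ 3 + t + c"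
  obtain e' where "Z (e * e' - 1)" using unit_N no_root e_def by blast
  then have e': "N (e * e' - 1)" by (rule N_if_Z)
  define s where "s = - y * e'"
  have lin: "a + b * t = - a * (b * y - 1)" by (simp add: t_def algebra_simps)
  have 0: "a = - b * t - a * (b * y - 1)" using lin by (simp add: algebra_simps)
  have "N (a * (s * (t ^ 2 + 1)) - c * (b * s) - 1)"
  proof (rule N.comb2[OF d e'])
    have "a * (s * (t ^ 2 + 1)) - c * (b * s) - 1 =
        (- b * t - a * (b * y - 1)) * (s * (t ^ 2 + 1)) - c * (b * s) - 1"
      using 0 by simp
    also have "\<dots> = (e * e' - a * (s * (t ^ 2 + 1))) * (b * y - 1) + 1 * (e * e' - 1)"
      unfolding s_def e_def by (simp add: algebra_simps power2_eq_square power3_eq_cube)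
    finally show "a * (s * (t ^ 2 + 1)) - c * (b * s) - 1 =
      (e * e' - a * (s * (t ^ 2 + 1))) * (b * y - 1) + 1 * (e * e' - 1)" .
  qed
  moreover have "N (a * (s * t) + b * (s * (t ^ 2 + 1)) - b * s)"
  proof (rule N.comb[OF d])
    have "a * (s * t) + b * (s * (t ^ 2 + 1)) - b * s = s * t * (a + b * t)"
      by (simp add: algebra_simps power2_eq_square)
    then show "a * (s * t) + b * (s * (t ^ 2 + 1)) - b * s = (- (s * t * a)) * (b * y - 1)"
      using lin by (simp add: algebra_simps)
  qed
  moreover have "N (a * s + b * (s * t))"
  proof (rule N.comb[OF d])
    have "a * s + b * (s * t) = s * (a + b * t)" by (simp add: algebra_simps)
    then show "a * s + b * (s * t) = (- (s * a)) * (b * y - 1)"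
      using lin by (simp add: algebra_simps)
  qed
  ultimately show ?thesis by (intro exI[of _ "(s * (t ^ 2 + 1), s * t, s)"]) simp
qed

lemma no_zero_divisor_if_inverse:
  assumes v: "all3 N (mul x v - (1, 0, 0))" and xy: "all3 N (mul x y)"
  shows "all3 N y"
proof -
  have "all3 N (mul y (mul x v) - y)" using N.vec_mult3[OF v, of c y] by (simp add: mult3_diff)
  moreover have "all3 N (mul y (mul x v))"
    using N.vec_mult3[OF xy, of c v] by (simp add: mul_ac)
  ultimately show ?thesis using N.vec_cong by blast
qed

text \<open>Multiplying a quadratic \<open>a + b \<theta> + w \<theta>\<^sup>2\<close> by \<open>w \<theta> - b\<close> lowers its degree.\<close>

lemma ex_inverse:
  assumes "\<not> all3 N u"
  shows "\<exists>v. all3 N (mul u v - (1, 0, 0))"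
proof (cases u)
  case (fields a b w)
  show ?thesis
  proof (cases "N w")
    case True
    then have "\<not> (N a \<and> N b)" using assms fields by simp
    then obtain v where v: "all3 N (mul (a, b, 0) v - (1, 0, 0))" using inverse_linear by blast
    have "all3 N (u - (a, b, 0))" using True fields by (simp add: N.zero)
    then have "all3 N (mul v u - mul v (a, b, 0))" by (rule N.mult3_cong)
    then have "all3 N (mul u v - mul (a, b, 0) v)" by (simp add: mult3_commute)
    then show ?thesis using N.vec_trans v by blast
  next
    case False
    then obtain v' where v': "all3 N (mul (- b, w, 0) v' - (1, 0, 0))" using inverse_linear by blast
    define l where "l = (- (a * b) - c * (w * w), a * w - b * b - w * w)"
    have l: "mul u (- b, w, 0) = (fst l, snd l, 0)"
      using fields by (simp add: l_def algebra_simps)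
    have "\<not> (N (fst l) \<and> N (snd l))"
    proof
      assume "N (fst l) \<and> N (snd l)"
      then have "all3 N (mul (- b, w, 0) u)" using l by (simp add: mult3_commute N.zero)
      then have "all3 N u" by (rule no_zero_divisor_if_inverse[OF v'])
      then show False using assms by blast
    qed
    then obtain z where "all3 N (mul (fst l, snd l, 0) z - (1, 0, 0))" using inverse_linear by blast
    then have "all3 N (mul u (mul (- b, w, 0) z) - (1, 0, 0))" by (simp only: l flip: mult3_assoc)
    then show ?thesis by blast
  qed
qed

lemma no_zero_divisor:
  "\<not> all3 N x \<Longrightarrow> all3 N (mul x y) \<Longrightarrow> all3 N y"
  using ex_inverse[of x] no_zero_divisor_if_inverse[of x] by blast

lemma sq_unimod: "\<not> all3 N u \<Longrightarrow> \<not> all3 N (sq u)"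
  unfolding sq_def using no_zero_divisor[of u u] by blast

lemma unimod_if_sq: "\<not> all3 N (sq u) \<Longrightarrow> \<not> all3 N u"
  unfolding sq_def using N.vec_mult3[of u c u] by blast

lemma sq_smult3: "sq (smult3 k u) = smult3 (k * k) (sq u)"
  unfolding sq_def by (rule mult3_smult3)

lemma two_smult3: "all3 N (smult3 2 x)"
  by (cases x) (simp add: N_two_mult)

text \<open>Modulo 2 the difference of the squares is the square of the difference, and a field has
  no nilpotent elements.\<close>

lemma sq_inj:
  assumes "all3 N (sq x - sq y)"
  shows "all3 N (x - y)"
proof -
  have "sq (x - y) = (sq x - sq y) + smult3 2 (sq y - mul x y)"
    unfolding sq_def by (cases x; cases y) (simp add: algebra_simps)
  then have "all3 N (sq (x - y))" using N.vec_add[OF assms two_smult3] by simp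
  then show ?thesis using sq_unimod by blast
qed

lemma sq_cong_N:
  assumes "all3 N (x - y)"
  shows "all3 N (sq x - sq y)"
proof -
  have "sq x - sq y = mul (x + y) (x - y)"
    unfolding sq_def by (cases x; cases y) (simp add: algebra_simps)
  then show ?thesis using N.vec_mult3[OF assms] by simp
qed

text \<open>Adding \<open>2 n\<close> to \<open>y\<close> changes the square by
  \<open>4 (n y + n^2) = 0\<close>. Congruence modulo \<open>N\<close> is thus lifted to equality in
  \<open>R\<close>, which is what makes the squares a canonical choice in each residue
  class.\<close>

lemma sq_cong:
  assumes "all3 N (x - y)"
  shows "all3 Z (sq x - sq y)"
proof -
  obtain n where n: "all3 Z (x - y - smult3 2 n)" using vec_two[OF assms] by blast
  have "sq x - sq y = mul (x + y) (x - y - smult3 2 n)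
      + smult3 2 (mul n (x - y)) + smult3 4 (mul n y)"
    unfolding sq_def by (cases x; cases y; cases n) (simp add: algebra_simps)
  moreover have "all3 Z (mul (x + y) (x - y - smult3 2 n))" by (rule Z.vec_mult3[OF n])
  moreover have "all3 Z (smult3 2 (mul n (x - y)))"
    using N.vec_mult3[OF assms] by (simp flip: vec_N_iff)
  moreover have "all3 Z (smult3 4 (mul n y))" by (rule Z.vec_smult3_scalar[OF Z_4])
  ultimately show ?thesis using Z.vec_add by metis
qed

lemma ex_sq: "\<exists>u. all3 N (sq u - w)"
proof -
  obtain D where "transversal N D" using ex_transversal_N by blast
  then have D: "transversal (all3 N) (D \<times> D \<times> D)" by (rule transversal_all3)
  have "(\<forall>y. \<exists>x. all3 N (sq x - y)) \<longleftrightarrow> (\<forall>x y. all3 N (sq x - sq y) \<longrightarrow> all3 N (x - y))"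
    by (rule transversal_surj_iff_inj[OF D]) (rule sq_cong_N)
  then show ?thesis using sq_inj by blast
qed

text \<open>Neighbouring squares span the same point: modulo \<open>N\<close> the factor between
  them is a square \<open>k^2\<close>, so \<open>v\<close> is congruent to \<open>k u\<close> by
  injectivity, and then \<open>sq v = k^2 sq u\<close> holds already in \<open>R\<close>.\<close>

lemma par_sq_if_cross:
  assumes u: "\<not> all3 N u" and v: "\<not> all3 N v" and uv: "all3 N (cross (sq u) (sq v))"
  shows "par (sq u) (sq v)"
proof -
  obtain a where a: "all3 N (sq v - smult3 a (sq u))"
    using parallel_N[OF sq_unimod[OF u] uv] by blast
  obtain k where k: "N (k * k - a)" using ex_sqrt by blast
  have "all3 N (smult3 (k * k - a) (sq u))" by (rule N.vec_smult3_scalar[OF k])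
  from N.vec_diff[OF a this] have "all3 N (sq v - sq (smult3 k u))"
    by (simp add: sq_smult3 smult3_diff)
  then have "all3 Z (sq v - smult3 (k * k) (sq u))"
    using sq_cong[OF sq_inj, of v "smult3 k u"] by (simp add: sq_smult3)
  then show ?thesis by (rule par_if_cong[OF sq_unimod[OF v]])
qed

lemma cross_sq:
  assumes u: "\<not> all3 N u" and uv: "all3 N (cross u v)"
  shows "all3 N (cross (sq u) (sq v))"
proof -
  obtain a where "all3 N (v - smult3 a u)" using parallel_N[OF u uv] by blast
  then have "all3 N (sq v - smult3 (a * a) (sq u))" using sq_cong_N by (simp flip: sq_smult3)
  then show ?thesis by (rule N.cross_smult3_cong)
qed

text \<open>In characteristic 2, if \<open>t\<close> has no constant term, then neither has \<open>t\<^sup>2\<close>; so after subtracting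
  the constant term of \<open>t\<close> the quadratic relation becomes \<open>t (a t - d) = 0\<close>.\<close>

lemma scalar_if_quadratic:
  assumes E: "all3 N (smult3 a (sq t) + (b, 0, 0) - smult3 d t)" and d: "\<not> N d"
  shows "\<exists>s. all3 N (t - (s, 0, 0))"
proof (cases t)
  case (fields t0 t1 t2)
  define t' :: "'a vec3" where "t' = (0, t1, t2)"
  have t: "t = (t0, 0, 0) + t'" using fields t'_def by simp
  define e where "e = a * (t0 * t0) + b - d * t0"
  have eq: "smult3 a (sq t) + (b, 0, 0) - smult3 d t =
      mul t' (smult3 a t' - (d, 0, 0)) + smult3 2 (smult3 (a * t0) t') + (e, 0, 0)"
    unfolding t sq_def e_def t'_def by (simp add: algebra_simps)
  have "N (- c * (2 * (t1 * (a * t2))) + e)"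
    using E unfolding eq t'_def by (simp add: algebra_simps)
  then have e: "N e"
    by (rule N.comb2[OF _ N_two_mult[of "t1 * (a * t2)"], where a = 1 and b = c])
      (simp add: algebra_simps)
  have "all3 N (mul t' (smult3 a t' - (d, 0, 0)))"
    using N.vec_diff[OF E N.vec_add[OF two_smult3[of "smult3 (a * t0) t'"], of "(e, 0, 0)"]] e
    unfolding eq by (simp add: N.zero add.assoc)
  then have "all3 N t' \<or> all3 N (smult3 a t' - (d, 0, 0))" using no_zero_divisor by blast
  moreover have "\<not> all3 N (smult3 a t' - (d, 0, 0))"
    using d N.uminus[of "- d"] by (auto simp: t'_def)
  ultimately show ?thesis using t by (intro exI[of _ t0]) simp
qed

text \<open>Dividing by \<open>v^2\<close> gives a quadratic relation for \<open>t = u / v\<close>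
  with a unit as middle coefficient. So \<open>t\<close> is a scalar modulo \<open>N\<close>, and
  \<open>u\<close> is proportional to \<open>v\<close>.\<close>

lemma cross_if_quadratic:
  assumes E: "all3 N (smult3 a (sq u) + smult3 b (sq v) - smult3 d (mul u v))"
    and d: "\<not> N d" and v: "\<not> all3 N v"
  shows "all3 N (cross v u)"
proof -
  obtain v' where v': "all3 N (mul v v' - (1, 0, 0))" using ex_inverse[OF v] by blast
  define t where "t = mul u v'"
  \<comment> \<open>The product \<open>mul v v'\<close> is 1 only modulo \<open>N\<close>; naming it
    keeps the next identity exact in the ring, and it is replaced by 1 afterwards.\<close>
  define e where "e = mul v v'"
  have e: "all3 N (e - (1, 0, 0))" using v' e_def by simp
  have "mul (sq v') (smult3 a (sq u) + smult3 b (sq v) - smult3 d (mul u v)) =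
      smult3 a (sq t) + smult3 b (sq e) - smult3 d (mul t e)"
    unfolding t_def e_def sq_def by (simp add: mult3_add mult3_diff mult3_smult3_right mul_ac)
  then have 1: "all3 N (smult3 a (sq t) + smult3 b (sq e) - smult3 d (mul t e))"
    using N.vec_mult3[OF E, of c "sq v'"] by simp
  have "all3 N (sq e - sq (1, 0, 0))" by (rule sq_cong_N[OF e])
  then have 2: "all3 N (smult3 b (sq e - (1, 0, 0)))"
    by (intro N.vec_smult3) (simp add: sq_def)
  have 3: "all3 N (smult3 d (mul t e - t))"
    using N.vec_smult3[OF N.mult3_cong[OF e]] by simp
  have "all3 N (smult3 a (sq t) + (b, 0, 0) - smult3 d t)"
    using N.vec_add[OF N.vec_diff[OF 1 2] 3] by (simp add: smult3_diff_right algebra_simps)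
  then obtain s where s: "all3 N (t - (s, 0, 0))" using scalar_if_quadratic[OF _ d] by blast
  have "all3 N (mul v t - mul v (s, 0, 0))" by (rule N.mult3_cong[OF s])
  moreover have "all3 N (mul u e - mul u (1, 0, 0))" by (rule N.mult3_cong[OF e])
  moreover have "mul u e = mul v t" unfolding t_def e_def by (simp add: mul_ac)
  ultimately have "all3 N (u - smult3 s v)"
    using N.vec_trans[OF N.vec_sym] by (metis mult3_one mult3_scalar)
  then show ?thesis by (rule N.cross_smult3_cong)
qed

text \<open>Collinearity makes the third square an \<open>R\<close>-combination of the first two. It
  is also the square of a combination of \<open>u1\<close> and \<open>u2\<close>, and comparing the
  two expressions leaves twice a quadratic relation between \<open>u1\<close> and \<open>u2\<close>,
  whose mixed coefficient is a unit.\<close>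

lemma squares_not_collinear:
  assumes u: "\<not> all3 N u1" "\<not> all3 N u2" "\<not> all3 N u3" and v: "\<not> all3 N v"
    and dot: "Z (dot3 v (sq u1))" "Z (dot3 v (sq u2))" "Z (dot3 v (sq u3))"
    and n: "\<not> all3 N (cross (sq u1) (sq u2))" "\<not> all3 N (cross (sq u1) (sq u3))"
      "\<not> all3 N (cross (sq u2) (sq u3))"
  shows False
proof -
  let ?w = "cross (sq u1) (sq u2)"
  \<comment> \<open>The line \<open>v\<close> through two non-neighbouring points is their cross
    product up to a factor, so \<open>sq u3\<close> is orthogonal to this cross product as well and
    Cramer's rule applies.\<close>
  have "cross ?w v = smult3 (dot3 v (sq u1)) (sq u2) - smult3 (dot3 v (sq u2)) (sq u1)"
    by (cases v; cases "sq u1"; cases "sq u2") (simp add: algebra_simps)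
  then have "all3 Z (cross ?w v)" using dot by (simp add: Z.vec_diff Z.vec_smult3_scalar)
  then obtain k where k: "all3 Z (?w - smult3 k v)" using parallel_Z[OF v] by blast
  have "Z (dot3 (smult3 k v) (sq u3))" using dot(3) by (simp add: dot3_smult3_left Z.mult)
  then have "Z (dot3 (sq u3) ?w)" using Z.dot3_cong[OF k] dot3_commute by metis
  moreover obtain t where "Z (dot3 t ?w - 1)" using unimod n(1) by blast
  ultimately obtain a b where ab: "all3 Z (sq u3 - (smult3 a (sq u1) + smult3 b (sq u2)))"
    using Z.span_if_dot3_cross by blast
  \<comment> \<open>If a coefficient were in \<open>N\<close>, the third point would be a neighbour
    of one of the first two.\<close>
  have a: "\<not> N a"
  proof
    assume "N a"
    then have "all3 N (smult3 a (sq u1))" by (rule N.vec_smult3_scalar)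
    from N.vec_add[OF vec_N_if_Z[OF ab] this] have "all3 N (sq u3 - smult3 b (sq u2))"
      by (simp add: algebra_simps)
    then show False using N.cross_smult3_cong n(3) by blast
  qed
  have b: "\<not> N b"
  proof
    assume "N b"
    then have "all3 N (smult3 b (sq u2))" by (rule N.vec_smult3_scalar)
    from N.vec_add[OF vec_N_if_Z[OF ab] this] have "all3 N (sq u3 - smult3 a (sq u1))"
      by (simp add: algebra_simps)
    then show False using N.cross_smult3_cong n(2) by blast
  qed
  obtain r where r: "N (r * r - a)" using ex_sqrt by blast
  obtain s where s: "N (s * s - b)" using ex_sqrt by blast
  have rs: "\<not> N (r * s)"
  proof
    assume "N (r * s)"
    then consider "N r" | "N s" using N_prime by blast
    then show False
      using a b N.cong[OF r] N.cong[OF s] N.mult by (metis)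
  qed
  \<comment> \<open>Modulo \<open>N\<close> the square of \<open>y\<close> is
    \<open>a sq u1 + b sq u2\<close>, hence it is \<open>sq u3\<close>. By \<open>sq_inj\<close> and
    \<open>sq_cong\<close> this congruence becomes an equality in \<open>R\<close>.\<close>
  define y where "y = smult3 r u1 + smult3 s u2"
  have sq_y: "sq y = smult3 (r * r) (sq u1) + smult3 (s * s) (sq u2) + smult3 2 (smult3 (r * s) (mul u1 u2))"
    unfolding y_def sq_def by (cases u1; cases u2) (simp add: algebra_simps)
  have eq: "sq u3 - sq y = (sq u3 - (smult3 a (sq u1) + smult3 b (sq u2)))
      - (smult3 (r * r - a) (sq u1) + smult3 (s * s - b) (sq u2) + smult3 2 (smult3 (r * s) (mul u1 u2)))"
    unfolding sq_y smult3_diff by (simp add: algebra_simps)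
  have "all3 N (sq u3 - sq y)"
    unfolding eq by (intro N.vec_diff[OF vec_N_if_Z[OF ab]] N.vec_add two_smult3
        N.vec_smult3_scalar[OF r] N.vec_smult3_scalar[OF s])
  then have zy: "all3 Z (sq u3 - sq y)" by (rule sq_cong[OF sq_inj])
  obtain r' where r': "Z (r * r - a - 2 * r')" using two_dvd r N_def by blast
  obtain s' where s': "Z (s * s - b - 2 * s')" using two_dvd s N_def by blast
  \<comment> \<open>Writing \<open>r^2 = a + 2 r'\<close> and \<open>s^2 = b + 2 s'\<close>, the two
    expressions for \<open>sq u3\<close> differ by twice the vector on the left, so this vector
    vanishes modulo \<open>N\<close>.\<close>
  have eq2: "smult3 2 (smult3 r' (sq u1) + smult3 s' (sq u2) - smult3 (- (r * s)) (mul u1 u2)) =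
      (sq u3 - (smult3 a (sq u1) + smult3 b (sq u2))) - (sq u3 - sq y)
      - (smult3 (r * r - a - 2 * r') (sq u1) + smult3 (s * s - b - 2 * s') (sq u2))"
    unfolding sq_y
    by (cases "sq u1"; cases "sq u2"; cases "mul u1 u2"; cases "sq u3") (simp add: algebra_simps)
  have "all3 N (smult3 r' (sq u1) + smult3 s' (sq u2) - smult3 (- (r * s)) (mul u1 u2))"
    unfolding vec_N_iff eq2 by (intro Z.vec_diff Z.vec_add ab zy
        Z.vec_smult3_scalar[OF r'] Z.vec_smult3_scalar[OF s'])
  then have "all3 N (cross u2 u1)"
    by (rule cross_if_quadratic) (use rs N.uminus[of "- (r * s)"] u in auto)
  then show False using cross_sq[OF u(1) N.cross_sym] n(1) by blast
qed

end

section \<open>Line intersections of the hyperoval and the dual arc\<close>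

context galois_cubic
begin

text \<open>The hyperoval as a set of vectors: all vectors in \<open>U3\<close> of its points are
  included, so that counts are uniformly \<open>m\<close> times the number of points.\<close>

definition H :: "'a vec3 set" where
  "H = {v \<in> U3. \<exists>u. \<not> all3 N u \<and> par (sq u) v}"

lemma H_subset: "H \<subseteq> U3"
  by (auto simp: H_def)

lemma finite_H: "finite H"
  using H_subset finite_U3 finite_subset by blast

lemma U3_unimod: "w \<in> U3 \<Longrightarrow> \<not> all3 N w"
  by (simp add: U3_def)

lemma H_unimod: "h \<in> H \<Longrightarrow> \<not> all3 N h"
  by (simp add: H_def U3_def)

lemma par_closed_H: "h \<in> H \<Longrightarrow> x \<in> U3 \<Longrightarrow> par h x \<Longrightarrow> x \<in> H"
  unfolding H_def using par_trans by blast

lemma par_if_cross_H: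
  assumes "h \<in> H" "h' \<in> H" "all3 N (cross h h')"
  shows "par h h'"
proof -
  obtain u where u: "\<not> all3 N u" "par (sq u) h" using assms(1) unfolding H_def by blast
  obtain v where v: "\<not> all3 N v" "par (sq v) h'" using assms(2) unfolding H_def by blast
  have un: "\<not> all3 N h" "\<not> all3 N h'" using assms H_unimod by blast+
  have "all3 N (cross (sq u) h')"
    using cross_trans[OF sq_unimod[OF u(1)] un(1) cross_par[OF u(2)] assms(3)] .
  then have "all3 N (cross (sq u) (sq v))"
    using cross_trans[OF sq_unimod[OF u(1)] un(2) _ cross_par[OF par_sym[OF v(2)]]] by blast
  then have "par (sq u) (sq v)" by (rule par_sq_if_cross[OF u(1) v(1)])
  then show ?thesis using par_trans[OF par_sym[OF u(2)] par_trans[OF _ v(2)]] by blast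
qed

text \<open>Squaring is onto modulo \<open>N\<close>, so the residue class of \<open>w\<close>
  itself contains a square. Together with \<open>par_if_cross_H\<close>, each neighbour class has
  exactly one point of the hyperoval.\<close>

lemma ex_neighbour_H:
  assumes w: "w \<in> U3"
  shows "\<exists>h\<in>H. all3 N (cross w h)"
proof -
  obtain u where u: "all3 N (sq u - w)" using ex_sq by blast
  have su: "\<not> all3 N (sq u)" using N.vec_cong[OF u] U3_unimod[OF w] by simp
  define h where "h = T3.rep (sq u)"
  have h: "h \<in> C3" "all3 Z (sq u - h)" using T3.rep by (auto simp: h_def)
  have hn: "\<not> all3 N h" using su vec_N_cong[OF h(2)] by blast
  have "par (sq u) h"
    using par_if_cong[OF hn, of 1 "sq u"] Z.vec_sym[OF h(2)] by simp
  then have hH: "h \<in> H" using h(1) hn unimod_if_sq[OF su] unfolding H_def U3_def by blast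
  have "all3 N (h - w)"
    using N.vec_trans[OF N.vec_sym[OF vec_N_if_Z[OF h(2)]] u] .
  then have "all3 N (cross w h)" using N.cross_smult3_cong[of h 1 w] by simp
  then show ?thesis using hH by blast
qed

lemma card_neighbours_H:
  assumes w: "w \<in> U3"
  shows "card {h \<in> H. all3 N (cross w h)} = m"
proof -
  obtain h where h: "h \<in> H" "all3 N (cross w h)" using ex_neighbour_H[OF w] by blast
  have un: "\<not> all3 N h" "\<not> all3 N w" using h w H_unimod U3_unimod by blast+
  have "{x \<in> H. all3 N (cross w x)} = {x \<in> U3. par h x}"
  proof (intro equalityI subsetI)
    fix x assume x: "x \<in> {x \<in> H. all3 N (cross w x)}"
    then have "all3 N (cross h x)"
      using cross_trans[OF un N.cross_sym[OF h(2)], of x] by blast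
    then show "x \<in> {x \<in> U3. par h x}" using par_if_cross_H[OF h(1)] x H_subset by blast
  next
    fix x assume x: "x \<in> {x \<in> U3. par h x}"
    then have "x \<in> H" using par_closed_H[OF h(1)] by blast
    moreover have "all3 N (cross w x)"
      using cross_trans[OF un(2,1) h(2) cross_par] x by blast
    ultimately show "x \<in> {x \<in> H. all3 N (cross w x)}" by blast
  qed
  then show ?thesis using card_par[OF un(1)] by simp
qed

text \<open>Neighbouring pairs from \<open>U3\<close> and \<open>H\<close> are counted twice: every
  \<open>w\<close> has \<open>m\<close> neighbours in \<open>H\<close>, and every \<open>h\<close>
  has \<open>m q^2\<close> neighbours in \<open>U3\<close>.\<close>

lemma card_H: "int (card H) = int m * (int q ^ 2 + int q + 1)"
proof -
  have "card U3 * m = (\<Sum>w\<in>U3. card {h \<in> H. all3 N (cross w h)})"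
    using card_neighbours_H by simp
  also have "\<dots> = (\<Sum>h\<in>H. card {w \<in> U3. all3 N (cross w h)})"
    by (rule sum_card_swap[OF finite_U3 finite_H])
  finally have eq: "card U3 * m = (\<Sum>h\<in>H. card {w \<in> U3. all3 N (cross w h)})" .
  have "int (card U3) * int m = (\<Sum>h\<in>H. int (card {w \<in> U3. all3 N (cross w h)}))"
    using arg_cong[OF eq, of int] by simp
  also have "\<dots> = (\<Sum>h\<in>H. int m * int q ^ 2)"
  proof (rule sum.cong[OF refl])
    fix h assume "h \<in> H"
    then have "\<not> all3 N h" by (rule H_unimod)
    moreover have "{w \<in> U3. all3 N (cross w h)} = {w \<in> U3. all3 N (cross h w)}"
      by (rule Collect_cong) (metis N.cross_sym)
    ultimately show "int (card {w \<in> U3. all3 N (cross w h)}) = int m * int q ^ 2"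
      using card_neighbours by simp
  qed
  finally have "(int m * int q ^ 2) * (int m * (int q ^ 2 + int q + 1)) = (int m * int q ^ 2) * int (card H)"
    unfolding card_U3_eq by (simp add: algebra_simps)
  then show ?thesis using m_pos q_pos by simp
qed

definition z :: "'a vec3 \<Rightarrow> nat" where
  "z w = card {h \<in> H. Z (dot3 w h)}"

text \<open>A line carries at most two points of the hyperoval: three different ones would be
  pairwise non-neighbouring and collinear.\<close>

lemma z_le:
  assumes w: "w \<in> U3"
  shows "z w \<le> 2 * m"
proof (cases "\<exists>h1 h2. h1 \<in> H \<and> h2 \<in> H \<and> Z (dot3 w h1) \<and> Z (dot3 w h2) \<and> \<not> par h1 h2")
  case True
  then obtain h1 h2 where h: "h1 \<in> H" "h2 \<in> H" "Z (dot3 w h1)" "Z (dot3 w h2)" "\<not> par h1 h2"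
    by blast
  have un: "\<not> all3 N h1" "\<not> all3 N h2" using h H_unimod by blast+
  have "par h1 x \<or> par h2 x" if x: "x \<in> H" "Z (dot3 w x)" for x
  proof (rule ccontr)
    assume np: "\<not> (par h1 x \<or> par h2 x)"
    obtain u1 where u1: "\<not> all3 N u1" "par (sq u1) h1" using h(1) unfolding H_def by blast
    obtain u2 where u2: "\<not> all3 N u2" "par (sq u2) h2" using h(2) unfolding H_def by blast
    obtain u3 where u3: "\<not> all3 N u3" "par (sq u3) x" using x(1) unfolding H_def by blast
    have ncross: "\<not> all3 N (cross (sq u) (sq v))"
      if "\<not> all3 N u" "\<not> all3 N v" "par (sq u) y" "par (sq v) y'" "\<not> par y y'" for u v y y'
      using that(5) par_sq_if_cross[OF that(1,2)]
        par_trans[OF par_sym[OF that(3)] par_trans[OF _ that(4)]] by blast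
    have dot: "Z (dot3 w (sq u))" if "par (sq u) y" "Z (dot3 w y)" for u y
      using dot3_par[OF that(1), of w] that(2) by (simp add: dot3_commute)
    show False
    proof (rule squares_not_collinear[OF u1(1) u2(1) u3(1) U3_unimod[OF w]])
      show "Z (dot3 w (sq u1))" "Z (dot3 w (sq u2))" "Z (dot3 w (sq u3))"
        using dot u1(2) u2(2) u3(2) h(3,4) x(2) by blast+
      show "\<not> all3 N (cross (sq u1) (sq u2))" using ncross[OF u1(1) u2(1) u1(2) u2(2) h(5)] .
      show "\<not> all3 N (cross (sq u1) (sq u3))" using ncross[OF u1(1) u3(1) u1(2) u3(2)] np by blast
      show "\<not> all3 N (cross (sq u2) (sq u3))" using ncross[OF u2(1) u3(1) u2(2) u3(2)] np by blast
    qed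
  qed
  then have "{h \<in> H. Z (dot3 w h)} \<subseteq> {x \<in> U3. par h1 x} \<union> {x \<in> U3. par h2 x}"
    using H_subset by blast
  then have "z w \<le> card ({x \<in> U3. par h1 x} \<union> {x \<in> U3. par h2 x})"
    unfolding z_def by (intro card_mono) auto
  also have "\<dots> \<le> card {x \<in> U3. par h1 x} + card {x \<in> U3. par h2 x}" by (rule card_Un_le)
  finally show ?thesis using card_par un by simp
next
  case False
  show ?thesis
  proof (cases "{h \<in> H. Z (dot3 w h)} = {}")
    case True
    then show ?thesis unfolding z_def True by simp
  next
    case ne: False
    then obtain h where h: "h \<in> H" "Z (dot3 w h)" by blast
    have "{h \<in> H. Z (dot3 w h)} \<subseteq> {x \<in> U3. par h x}" using False h H_subset by blast
    then have "z w \<le> card {x \<in> U3. par h x}" unfolding z_def by (intro card_mono) auto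
    then show ?thesis using card_par[OF H_unimod[OF h(1)]] by simp
  qed
qed

text \<open>In \<open>sum_card_W\<close> the neighbour class of \<open>p\<close> always contributes
  \<open>m\<close> vectors of \<open>H\<close>; membership of \<open>p\<close> in \<open>H\<close>
  only decides whether the term for \<open>p\<close> itself is present.\<close>

lemma sum_z:
  assumes p: "p \<in> U3"
  shows "(\<Sum>w\<in>W p. int (z w)) =
    int m * (if p \<in> H then 2 * int m * (int q ^ 2 + int q) else int m * (int q ^ 2 + 2 * int q))"
proof -
  have "card {x \<in> H. par p x} = (if p \<in> H then m else 0)"
  proof (cases "p \<in> H")
    case True
    then have "{x \<in> H. par p x} = {x \<in> U3. par p x}" using par_closed_H H_subset by blast
    then show ?thesis using True card_par[OF U3_unimod[OF p]] by simp
  next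
    case False
    then have "{x \<in> H. par p x} = {}" using par_closed_H p par_sym by blast
    then show ?thesis unfolding z_def using False by (simp only: card.empty if_False)
  qed
  then show ?thesis
    using sum_card_W[OF U3_unimod[OF p] H_subset] card_neighbours_H[OF p] card_H
    unfolding z_def by (simp add: algebra_simps)
qed

text \<open>There are no tangents: the average of \<open>z\<close> over the lines through a point of \<open>H\<close> is the
  maximum \<open>2 m\<close>.\<close>

lemma z_cases:
  assumes w: "w \<in> U3"
  shows "z w = 0 \<or> z w = 2 * m"
proof (cases "z w = 0")
  case False
  then have "{h \<in> H. Z (dot3 w h)} \<noteq> {}" unfolding z_def by (metis card.empty)
  then obtain h where h: "h \<in> H" "Z (dot3 w h)" by blast
  have hU: "h \<in> U3" using h H_subset by blast
  have wW: "w \<in> W h" using w h by (simp add: W_def)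
  have le: "int (z v) \<le> 2 * int m" if "v \<in> W h" for v
    using z_le[of v] that by (auto simp: W_def)
  have "(\<Sum>v\<in>W h. 2 * int m - int (z v)) = 0"
    using sum_z[OF hU] h(1) card_W[OF U3_unimod[OF hU]]
    by (simp add: sum_subtractf algebra_simps)
  then have "2 * int m - int (z w) = 0"
    using sum_nonneg_eq_0_iff[of "W h" "\<lambda>v. 2 * int m - int (z v)"] le wW by simp
  then show ?thesis by simp
qed simp

text \<open>Since \<open>z\<close> takes only the values \<open>0\<close> and \<open>2 m\<close>,
  the sum of \<open>2 m - z w\<close> counts the lines that miss the hyperoval, with weight
  \<open>2 m\<close>.\<close>

lemma card_z_zero:
  assumes "A \<subseteq> U3"
  shows "2 * int m * int (card {w \<in> A. z w = 0}) = 2 * int m * int (card A) - (\<Sum>w\<in>A. int (z w))"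
proof -
  have fin: "finite A" using assms finite_U3 finite_subset by blast
  have "2 * int m * int (card A) - (\<Sum>w\<in>A. int (z w)) = (\<Sum>w\<in>A. 2 * int m - int (z w))"
    by (simp add: sum_subtractf)
  also have "\<dots> = (\<Sum>w\<in>A. if z w = 0 then 2 * int m else 0)"
  proof (rule sum.cong[OF refl])
    fix w assume "w \<in> A"
    then show "2 * int m - int (z w) = (if z w = 0 then 2 * int m else 0)"
      using z_cases[of w] assms m_pos by auto
  qed
  also have "\<dots> = 2 * int m * int (card {w \<in> A. z w = 0})"
    using fin by (simp flip: sum.inter_filter)
  finally show ?thesis by simp
qed

lemma ex_arc:
  "\<exists>K \<subseteq> U3. (\<forall>x\<in>K. \<forall>y\<in>U3. par x y \<longrightarrow> y \<in> K)
    \<and> 2 * int (card K) = int m * (int q ^ 4 - int q)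
    \<and> (\<forall>w\<in>U3. card {x \<in> K. Z (dot3 w x)} = 0
        \<or> 2 * int (card {x \<in> K. Z (dot3 w x)}) = int m * int q ^ 2)"
\<comment> \<open>Line vectors and point vectors have the same form and \<open>dot3\<close> is
  symmetric, so the lines missing the hyperoval can be read as points, and a line \<open>p\<close>
  of the dual plane as a point \<open>p\<close>.\<close>
proof (intro exI[of _ "{x \<in> U3. z x = 0}"] conjI ballI impI)
  fix x y assume *: "x \<in> {x \<in> U3. z x = 0}" "y \<in> U3" "par x y"
  then have "z y = z x" unfolding z_def using dot3_par[OF *(3)] by simp
  then show "y \<in> {x \<in> U3. z x = 0}" using * by simp
next
  have "(\<Sum>w\<in>U3. z w) = (\<Sum>h\<in>H. card {w \<in> U3. Z (dot3 w h)})"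
    unfolding z_def by (rule sum_card_swap[OF finite_U3 finite_H])
  then have "(\<Sum>w\<in>U3. int (z w)) = (\<Sum>h\<in>H. int (card (W h)))"
    unfolding W_def by (simp flip: of_nat_sum)
  also have "\<dots> = (\<Sum>h\<in>H. int m * (int q ^ 2 + int q))"
    using card_W[OF H_unimod] by (intro sum.cong) simp_all
  finally have "(\<Sum>w\<in>U3. int (z w)) = int m * (int q ^ 2 + int q + 1) * (int m * (int q ^ 2 + int q))"
    using card_H by simp
  then have "int m * (2 * int (card {x \<in> U3. z x = 0})) =
      int m * (2 * (int m * int q ^ 2 * (int q ^ 2 + int q + 1)) -
        (int q ^ 2 + int q + 1) * (int m * (int q ^ 2 + int q)))"
    using card_z_zero[OF subset_refl] card_U3_eq by (simp add: algebra_simps)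
  then have "2 * int (card {x \<in> U3. z x = 0}) =
      2 * (int m * int q ^ 2 * (int q ^ 2 + int q + 1)) -
        (int q ^ 2 + int q + 1) * (int m * (int q ^ 2 + int q))"
    using m_pos by simp
  then show "2 * int (card {x \<in> U3. z x = 0}) = int m * (int q ^ 4 - int q)"
    by Groebner_Basis.algebra
next
  fix p assume p: "p \<in> U3"
  have eq: "{x \<in> {x \<in> U3. z x = 0}. Z (dot3 p x)} = {x \<in> W p. z x = 0}"
    by (auto simp: W_def dot3_commute)
  have W: "W p \<subseteq> U3" by (auto simp: W_def)
  show "card {x \<in> {x \<in> U3. z x = 0}. Z (dot3 p x)} = 0 \<or>
    2 * int (card {x \<in> {x \<in> U3. z x = 0}. Z (dot3 p x)}) = int m * int q ^ 2"
  proof (cases "p \<in> H")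
    \<comment> \<open>Every line through a hyperoval point meets the hyperoval.\<close>
    case True
    have "2 * int m * int (card {w \<in> W p. z w = 0}) = 0"
      using card_z_zero[OF W] sum_z[OF p] True card_W[OF U3_unimod[OF p]] by (simp add: algebra_simps)
    then show ?thesis unfolding eq using m_pos by simp
  next
    \<comment> \<open>Through a point off the hyperoval, the average of \<open>z\<close> leaves
      \<open>q^2 / 2\<close> lines that miss it.\<close>
    case False
    have "int m * (2 * int (card {w \<in> W p. z w = 0})) =
      int m * (2 * (int m * (int q ^ 2 + int q)) - int m * (int q ^ 2 + 2 * int q))"
      using card_z_zero[OF W] sum_z[OF p] False card_W[OF U3_unimod[OF p]] by (simp add: algebra_simps)
    then have "2 * int (card {w \<in> W p. z w = 0}) =
      2 * (int m * (int q ^ 2 + int q)) - int m * (int q ^ 2 + 2 * int q)"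
      using m_pos by simp
    then show ?thesis unfolding eq by (simp add: algebra_simps)
  qed
qed auto

end

context galois_like
begin

lemma ex_two_intersection_arc:
  "\<exists>K \<subseteq> U3. (\<forall>x\<in>K. \<forall>y\<in>U3. par x y \<longrightarrow> y \<in> K)
    \<and> 2 * int (card K) = int m * (int q ^ 4 - int q)
    \<and> (\<forall>w\<in>U3. card {x \<in> K. Z (dot3 w x)} = 0
        \<or> 2 * int (card {x \<in> K. Z (dot3 w x)}) = int m * int q ^ 2)"
proof -
  obtain c where "\<forall>t. \<not> N (t ^ 3 + t + c)" using ex_no_root by blast
  then interpret galois_cubic Z C c by unfold_locales blast
  show ?thesis by (rule ex_arc)
qed

end

section \<open>Points and lines of the Hjelmslev plane\<close>

text \<open>The bridge to the ring record: \<open>cls\<close> sends an element of the type to its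
  class, and the record operations are only required to agree with those of the type on
  classes.\<close>

locale galois_quotient = galois_like Z C
  for Z :: "'a::comm_ring_1 \<Rightarrow> bool" and C :: "'a set" +
  fixes R :: "('b, 'c) ring_scheme" and cls :: "'a \<Rightarrow> 'b"
  assumes carrier_R: "carrier R = range cls"
    and cls_eq: "cls x = cls y \<longleftrightarrow> Z (x - y)"
    and cls_mult: "cls x \<otimes>\<^bsub>R\<^esub> cls y = cls (x * y)"
    and cls_add: "cls x \<oplus>\<^bsub>R\<^esub> cls y = cls (x + y)"
begin

fun emb :: "'a vec3 \<Rightarrow> nat \<Rightarrow> 'b" where
  "emb (x, y, z) = (\<lambda>i\<in>{0..<3}. cls (if i = 0 then x else if i = 1 then y else z))"

lemma emb_eq: "emb x = emb y \<longleftrightarrow> all3 Z (x - y)"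
proof (cases x; cases y)
  fix a b c a' b' c' assume xy: "x = (a, b, c)" "y = (a', b', c')"
  show ?thesis
  proof
    assume e: "emb x = emb y"
    show "all3 Z (x - y)"
      using fun_cong[OF e, of 0] fun_cong[OF e, of 1] fun_cong[OF e, of 2] xy
      by (simp add: cls_eq)
  next
    assume "all3 Z (x - y)"
    then show "emb x = emb y" using xy by (auto simp: cls_eq restrict_def)
  qed
qed

lemma vecs3_eq: "vecs3 R = range emb"
proof (intro equalityI subsetI)
  fix v assume v: "v \<in> vecs3 R"
  then have "v i \<in> range cls" if "i < 3" for i
    using that carrier_R by (auto simp: vecs3_def PiE_iff)
  from this[of 0] this[of 1] this[of 2]
  obtain a b c where abc: "v 0 = cls a" "v 1 = cls b" "v 2 = cls c" by auto
  have "v = emb (a, b, c)"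
  proof
    fix i
    show "v i = emb (a, b, c) i"
    proof (cases "i < 3")
      case True
      then have "i = 0 \<or> i = 1 \<or> i = 2" by auto
      then show ?thesis using abc by auto
    next
      case False
      then show ?thesis using v by (auto simp: vecs3_def PiE_iff extensional_def)
    qed
  qed
  then show "v \<in> range emb" by blast
next
  fix v assume "v \<in> range emb"
  then obtain x where "v = emb x" by blast
  then show "v \<in> vecs3 R" by (cases x) (auto simp: vecs3_def carrier_R)
qed

lemma vsmul_emb: "vsmul R (emb x) (cls a) = emb (smult3 a x)"
  by (cases x) (auto simp: vsmul_def cls_mult restrict_def mult.commute)

lemma vadd_emb: "vadd R (emb x) (emb y) = emb (x + y)"
  by (cases x; cases y) (auto simp: vadd_def cls_add restrict_def)

declare emb.simps [simp del]

definition pt :: "'a vec3 \<Rightarrow> (nat \<Rightarrow> 'b) set" where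
  "pt x = emb ` range (\<lambda>a. smult3 a x)"

text \<open>Lines are given by an equation rather than by a basis, which makes incidence a single
  scalar condition; \<open>PHG_lines_eq\<close> identifies them with the free rank 2
  submodules.\<close>

definition ln :: "'a vec3 \<Rightarrow> (nat \<Rightarrow> 'b) set" where
  "ln w = emb ` {v. Z (dot3 w v)}"

lemma emb_mem_pt: "emb y \<in> pt x \<longleftrightarrow> (\<exists>a. all3 Z (y - smult3 a x))"
  by (auto simp: pt_def emb_eq)

lemma emb_mem_ln: "emb y \<in> ln w \<longleftrightarrow> Z (dot3 w y)"
proof
  assume "emb y \<in> ln w"
  then obtain v where v: "all3 Z (y - v)" "Z (dot3 w v)" unfolding ln_def using emb_eq by blast
  then show "Z (dot3 w y)" using Z.dot3_cong[OF v(1)] by (metis dot3_commute)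
qed (auto simp: ln_def)

lemma pt_eq_iff:
  assumes "\<not> all3 N x" "\<not> all3 N y"
  shows "pt x = pt y \<longleftrightarrow> par x y"
proof
  assume "pt x = pt y"
  moreover have "emb y \<in> pt y" unfolding emb_mem_pt by (rule exI[of _ 1]) simp
  ultimately have "emb y \<in> pt x" by simp
  then obtain a where "all3 Z (y - smult3 a x)" unfolding emb_mem_pt by blast
  then show "par x y" by (rule par_if_cong[OF assms(2)])
next
  have sub: "pt y \<subseteq> pt x" if xy: "par x y" for x y
  proof -
    obtain a where a: "all3 Z (y - smult3 a x)" using xy par_def by blast
    have "emb (smult3 b y) \<in> pt x" for b
      unfolding emb_mem_pt using Z.vec_smult3[OF a, of b]
      by (intro exI[of _ "b * a"]) (simp add: smult3_diff_right smult3_smult3)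
    then show ?thesis by (auto simp: pt_def)
  qed
  assume "par x y"
  then show "pt x = pt y" using sub[of x y] sub[of y x] par_sym[of x y] by simp
qed

lemma par_rep: "\<not> all3 N x \<Longrightarrow> par x (T3.rep x)"
  using par_if_cong[of "T3.rep x" 1 x] vec_N_cong[OF T3.rep(2)[of x]] Z.vec_sym[OF T3.rep(2)[of x]] by simp

lemma rep_U3: "\<not> all3 N x \<Longrightarrow> T3.rep x \<in> U3"
  using T3.rep(1)[of x] vec_N_cong[OF T3.rep(2)[of x]] by (simp add: U3_def)

lemma ln_par: "par w w' \<Longrightarrow> ln w = ln w'"
  unfolding ln_def using dot3_par by simp

lemma inj_on_range_iff:
  "inj_on f (range g) \<longleftrightarrow> (\<forall>a b. f (g a) = f (g b) \<longrightarrow> g a = g b)"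
  by (auto simp: inj_on_def)

lemma range_vsmul: "{vsmul R (emb x) a | a. a \<in> range cls} = pt x"
proof -
  have "{vsmul R (emb x) a | a. a \<in> range cls} = range (\<lambda>a. vsmul R (emb x) (cls a))" by blast
  then show ?thesis unfolding vsmul_emb pt_def by (simp add: image_image)
qed

lemma PHG_points_eq: "PHG_points R = pt ` U3"
proof (intro equalityI subsetI)
  fix M assume "M \<in> PHG_points R"
  then obtain x where M: "M = {vsmul R (emb x) a | a. a \<in> range cls}"
    and inj: "inj_on (vsmul R (emb x)) (range cls)"
    unfolding PHG_points_def vecs3_eq carrier_R by blast
  have Mx: "M = pt x" unfolding M by (rule range_vsmul)
  have x: "\<not> all3 N x"
  proof
    assume "all3 N x"
    \<comment> \<open>A generator with all coordinates in \<open>N\<close> is annihilated by 2, so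
      it is not a basis.\<close>
    then have "emb (smult3 2 x) = emb (smult3 0 x)"
      unfolding emb_eq using vec_N_iff by (simp flip: smult3_diff)
    then have "cls 2 = cls 0" using inj unfolding inj_on_range_iff vsmul_emb by blast
    then show False using not_Z_2 by (simp add: cls_eq)
  qed
  then have "M = pt (T3.rep x)"
    using Mx pt_eq_iff[OF x] par_rep[OF x] unimod_par by blast
  then show "M \<in> pt ` U3" using rep_U3[OF x] by blast
next
  fix M assume "M \<in> pt ` U3"
  then obtain x where x: "x \<in> U3" "M = pt x" by blast
  have xn: "\<not> all3 N x" using x(1) by (simp add: U3_def)
  have "M = {vsmul R (emb x) a | a. a \<in> range cls}"
    unfolding x(2) range_vsmul ..
  moreover have "inj_on (vsmul R (emb x)) (range cls)"
    unfolding inj_on_range_iff vsmul_emb emb_eq cls_eq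
    using smult3_cancel_Z[OF xn] by (simp flip: smult3_diff)
  ultimately show "M \<in> PHG_points R"
    unfolding PHG_points_def vecs3_eq carrier_R by blast
qed

lemma PHG_lines_iff:
  "M \<in> PHG_lines R \<longleftrightarrow> (\<exists>x y. M = emb ` range (\<lambda>(a, b). smult3 a x + smult3 b y) \<and>
    (\<forall>a b. all3 Z (smult3 a x + smult3 b y) \<longrightarrow> Z a \<and> Z b))"
proof -
  have span: "{vadd R (vsmul R (emb x) a) (vsmul R (emb y) b) | a b. a \<in> range cls \<and> b \<in> range cls} =
    emb ` range (\<lambda>(a, b). smult3 a x + smult3 b y)" for x y
  proof (intro equalityI subsetI)
    fix v assume "v \<in> {vadd R (vsmul R (emb x) a) (vsmul R (emb y) b) | a b. a \<in> range cls \<and> b \<in> range cls}"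
    then obtain a b where "v = vadd R (vsmul R (emb x) (cls a)) (vsmul R (emb y) (cls b))" by blast
    then have "v = emb ((\<lambda>(a, b). smult3 a x + smult3 b y) (a, b))"
      by (simp add: vsmul_emb vadd_emb)
    then show "v \<in> emb ` range (\<lambda>(a, b). smult3 a x + smult3 b y)"
      by (rule image_eqI[OF _ rangeI])
  next
    fix v assume "v \<in> emb ` range (\<lambda>(a, b). smult3 a x + smult3 b y)"
    then obtain a b where "v = vadd R (vsmul R (emb x) (cls a)) (vsmul R (emb y) (cls b))"
      unfolding vsmul_emb vadd_emb by auto
    then show "v \<in> {vadd R (vsmul R (emb x) a) (vsmul R (emb y) b) | a b. a \<in> range cls \<and> b \<in> range cls}"
      by blast
  qed
  have inj: "inj_on (\<lambda>(a, b). vadd R (vsmul R (emb x) a) (vsmul R (emb y) b)) (range cls \<times> range cls)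
    \<longleftrightarrow> (\<forall>a b. all3 Z (smult3 a x + smult3 b y) \<longrightarrow> Z a \<and> Z b)" (is "?l \<longleftrightarrow> ?r") for x y
  proof
    assume l: ?l
    show ?r
    proof (intro allI impI)
      fix a b assume "all3 Z (smult3 a x + smult3 b y)"
      then have "emb (smult3 a x + smult3 b y) = emb (smult3 0 x + smult3 0 y)"
        unfolding emb_eq by (cases x; cases y) simp
      then have "(cls a, cls b) = (cls 0, cls 0)"
        by (intro inj_onD[OF l]) (auto simp: vsmul_emb vadd_emb)
      then show "Z a \<and> Z b" by (simp add: cls_eq)
    qed
  next
    assume r: ?r
    show ?l
    proof (rule inj_onI)
      fix s t assume "s \<in> range cls \<times> range cls" "t \<in> range cls \<times> range cls"
        and eq: "(\<lambda>(a, b). vadd R (vsmul R (emb x) a) (vsmul R (emb y) b)) s =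
          (\<lambda>(a, b). vadd R (vsmul R (emb x) a) (vsmul R (emb y) b)) t"
      then obtain a b a' b' where st: "s = (cls a, cls b)" "t = (cls a', cls b')" by auto
      have "all3 Z (smult3 a x + smult3 b y - (smult3 a' x + smult3 b' y))"
        using eq unfolding st by (simp add: vsmul_emb vadd_emb emb_eq)
      then have "all3 Z (smult3 (a - a') x + smult3 (b - b') y)"
        by (simp add: smult3_diff algebra_simps)
      then show "s = t" using r by (simp add: st cls_eq)
    qed
  qed
  show ?thesis unfolding PHG_lines_def vecs3_eq carrier_R mem_Collect_eq bex_simps span inj by simp
qed

lemma span_eq_ln:
  assumes "\<not> all3 N (cross x y)"
  shows "emb ` range (\<lambda>(a, b). smult3 a x + smult3 b y) = ln (cross x y)"
proof (intro equalityI subsetI)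
  fix v assume "v \<in> emb ` range (\<lambda>(a, b). smult3 a x + smult3 b y)"
  then obtain a b where v: "v = emb (smult3 a x + smult3 b y)" by auto
  have "dot3 (cross x y) (smult3 a x + smult3 b y) = 0"
    by (cases x; cases y) (simp add: algebra_simps)
  then show "v \<in> ln (cross x y)" unfolding v emb_mem_ln by (simp add: Z.zero)
next
  fix v assume "v \<in> ln (cross x y)"
  then obtain z where z: "v = emb z" "Z (dot3 (cross x y) z)" by (auto simp: ln_def)
  obtain t where "Z (dot3 t (cross x y) - 1)" using unimod[OF assms] by blast
  then obtain a b where "all3 Z (z - (smult3 a x + smult3 b y))"
    using Z.span_if_dot3_cross z(2) dot3_commute by metis
  then have "v = emb ((\<lambda>(a, b). smult3 a x + smult3 b y) (a, b))"
    unfolding z(1) emb_eq by simp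
  then show "v \<in> emb ` range (\<lambda>(a, b). smult3 a x + smult3 b y)"
    by (rule image_eqI[OF _ rangeI])
qed

text \<open>Freeness of a pair is read off its cross product. Taking the cross product of a relation
  with \<open>y\<close> or \<open>x\<close> isolates one scalar times \<open>cross x y\<close>.
  Conversely, if \<open>2 (x \<times> y) = 0\<close>, suitable multiples of \<open>x\<close> and
  \<open>y\<close> give nontrivial relations.\<close>

lemma unimod_cross_iff:
  "\<not> all3 N (cross x y) \<longleftrightarrow> (\<forall>a b. all3 Z (smult3 a x + smult3 b y) \<longrightarrow> Z a \<and> Z b)"
proof
  assume n: "\<not> all3 N (cross x y)"
  show "\<forall>a b. all3 Z (smult3 a x + smult3 b y) \<longrightarrow> Z a \<and> Z b"
  proof (intro allI impI)
    fix a b assume v: "all3 Z (smult3 a x + smult3 b y)"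
    have "cross (smult3 a x + smult3 b y) y = smult3 a (cross x y)"
      "cross (smult3 a x + smult3 b y) x = smult3 (- b) (cross x y)"
      by (cases x; cases y; simp add: algebra_simps)+
    then have "all3 Z (smult3 a (cross x y))" "all3 Z (smult3 (- b) (cross x y))"
      using Z.vec_cross[OF v] by metis+
    then have "Z a" "Z (- b)" using smult3_cancel_Z[OF n] by blast+
    then show "Z a \<and> Z b" using Z.uminus[of "- b"] by simp
  qed
next
  assume r: "\<forall>a b. all3 Z (smult3 a x + smult3 b y) \<longrightarrow> Z a \<and> Z b"
  show "\<not> all3 N (cross x y)"
  proof
    assume n: "all3 N (cross x y)"
    obtain x0 x1 x2 y0 y1 y2 where xy: "x = (x0, x1, x2)" "y = (y0, y1, y2)"
      by (cases x; cases y)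
    have w: "Z (2 * (x1 * y2 - x2 * y1))" "Z (2 * (x2 * y0 - x0 * y2))" "Z (2 * (x0 * y1 - x1 * y0))"
      using n unfolding xy by (auto simp: N_def)
    note w' = w[THEN Z.uminus]
    \<comment> \<open>The coordinates of \<open>x_i y - y_i x\<close> are, up to sign, zero or
      coordinates of the cross product. Independence then forces \<open>2 x_i = 0\<close> for each
      \<open>i\<close>, so that \<open>2 x = 0\<close> is itself a nontrivial relation.\<close>
    have "all3 Z (smult3 (- 2 * y0) x + smult3 (2 * x0) y)"
      "all3 Z (smult3 (- 2 * y1) x + smult3 (2 * x1) y)"
      "all3 Z (smult3 (- 2 * y2) x + smult3 (2 * x2) y)"
      unfolding xy using w w' by (simp_all add: algebra_simps Z.zero)
    then have "Z (2 * x0)" "Z (2 * x1)" "Z (2 * x2)" using r by blast+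
    then have "all3 N x" by (simp add: xy N_def)
    then have "all3 Z (smult3 2 x + smult3 0 y)"
      unfolding vec_N_iff by (cases y; cases x) simp
    then show False using r not_Z_2 by blast
  qed
qed

lemma PHG_lines_eq: "PHG_lines R = ln ` U3"
proof (intro equalityI subsetI)
  fix M assume "M \<in> PHG_lines R"
  then obtain x y where M: "M = emb ` range (\<lambda>(a, b). smult3 a x + smult3 b y)"
    and n: "\<not> all3 N (cross x y)"
    unfolding PHG_lines_iff unimod_cross_iff[symmetric] by blast
  have "M = ln (T3.rep (cross x y))"
    unfolding M span_eq_ln[OF n] by (rule ln_par[OF par_rep[OF n]])
  then show "M \<in> ln ` U3" using rep_U3[OF n] by blast
next
  fix M assume "M \<in> ln ` U3"
  then obtain w where w: "w \<in> U3" and M: "M = ln w" by blast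
  obtain a b c where abc: "w = (a, b, c)" by (cases w)
  have "\<not> N a \<or> \<not> N b \<or> \<not> N c" using w unfolding abc by (auto simp: U3_def)
  \<comment> \<open>Two obvious solutions of the equation of \<open>w\<close> have a multiple of
    \<open>w\<close> as cross product. The pair is chosen so that the factor is, up to sign, a unit
    coordinate of \<open>w\<close>.\<close>
  moreover have "cross (- b, a, 0) (- c, 0, a) = smult3 a w"
    "cross (b, - a, 0) (0, - c, b) = smult3 (- b) w"
    "cross (c, 0, - a) (0, c, - b) = smult3 c w"
    unfolding abc by (simp_all add: algebra_simps)
  moreover have "\<not> N b \<Longrightarrow> \<not> N (- b)" using N.uminus[of "- b"] by auto
  ultimately obtain x y k where k: "\<not> N k" "cross x y = smult3 k w" by metis
  have p: "par w (cross x y)" unfolding par_def k(2) using k(1) by (intro exI[of _ k]) simp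
  have n: "\<not> all3 N (cross x y)" using unimod_par[OF p] w by (simp add: U3_def)
  have "M = emb ` range (\<lambda>(a, b). smult3 a x + smult3 b y)"
    unfolding M span_eq_ln[OF n] by (rule ln_par[OF p])
  then show "M \<in> PHG_lines R"
    unfolding PHG_lines_iff unimod_cross_iff[symmetric] using n by blast
qed

lemma pt_subset_ln_iff: "pt x \<subseteq> ln w \<longleftrightarrow> Z (dot3 w x)"
proof
  assume "pt x \<subseteq> ln w"
  moreover have "emb x \<in> pt x" unfolding emb_mem_pt by (rule exI[of _ 1]) simp
  ultimately show "Z (dot3 w x)" using emb_mem_ln by blast
next
  assume "Z (dot3 w x)"
  then have "emb (smult3 a x) \<in> ln w" for a
    unfolding emb_mem_ln by (simp add: dot3_smult3_right Z.mult)
  then show "pt x \<subseteq> ln w" unfolding pt_def by blast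
qed

section \<open>From vectors to points\<close>

lemma card_vectors_of_points:
  assumes "K \<subseteq> PHG_points R"
  shows "card {x \<in> U3. pt x \<in> K} = m * card K"
proof -
  have finK: "finite K" using assms unfolding PHG_points_eq by (rule finite_subset) simp
  have "{x \<in> U3. pt x \<in> K} = (\<Union>P\<in>K. {x \<in> U3. pt x = P})" by blast
  also have "card \<dots> = (\<Sum>P\<in>K. card {x \<in> U3. pt x = P})"
    using finK by (intro card_UN_disjoint) auto
  also have "\<dots> = (\<Sum>P\<in>K. m)"
  proof (rule sum.cong[OF refl])
    fix P assume "P \<in> K"
    then obtain y where y: "y \<in> U3" "P = pt y" using assms unfolding PHG_points_eq by blast
    have yn: "\<not> all3 N y" using y by (simp add: U3_def)
    have "{x \<in> U3. pt x = P} = {x \<in> U3. par y x}"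
      unfolding y(2) using pt_eq_iff[OF yn] by (auto simp: U3_def)
    then show "card {x \<in> U3. pt x = P} = m" using card_par[OF yn] by simp
  qed
  finally show ?thesis by simp
qed

lemma card_vectors_of_points_on_line:
  assumes "K \<subseteq> PHG_points R"
  shows "card {x \<in> {x \<in> U3. pt x \<in> K}. Z (dot3 w x)} = m * card {P \<in> K. P \<subseteq> ln w}"
proof -
  have "{x \<in> {x \<in> U3. pt x \<in> K}. Z (dot3 w x)} = {x \<in> U3. pt x \<in> {P \<in> K. P \<subseteq> ln w}}"
    using pt_subset_ln_iff by auto
  then show ?thesis using card_vectors_of_points[of "{P \<in> K. P \<subseteq> ln w}"] assms by auto
qed

lemma q_le_q4: "q \<le> q ^ 4"
  using self_le_power[of q 4] q_pos by simp

lemma arc_card_le: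
  assumes "proj_arc R K k (q\<^sup>2 div 2)"
  shows "k \<le> (q ^ 4 - q) div 2"
proof -
  have K: "K \<subseteq> PHG_points R" "card K = k"
    and lines: "\<And>L. L \<in> PHG_lines R \<Longrightarrow> card {P \<in> K. P \<subseteq> L} \<le> q\<^sup>2 div 2"
    using assms by (auto simp: proj_arc_def)
  let ?V = "{x \<in> U3. pt x \<in> K}"
  have "2 * int (card ?V) \<le> int m * (int q ^ 4 - int q)"
  proof (rule arc_upper_bound)
    fix x y assume *: "x \<in> ?V" "y \<in> U3" "par x y"
    then show "y \<in> ?V" using pt_eq_iff[of x y] by (simp add: U3_def)
  next
    fix w assume "w \<in> U3"
    then have "card {P \<in> K. P \<subseteq> ln w} \<le> q\<^sup>2 div 2" using lines PHG_lines_eq by blast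
    then have "2 * card {P \<in> K. P \<subseteq> ln w} \<le> q\<^sup>2" by linarith
    then have "m * (2 * card {P \<in> K. P \<subseteq> ln w}) \<le> m * q\<^sup>2" by (rule mult_le_mono2)
    then have "2 * card {x \<in> ?V. Z (dot3 w x)} \<le> m * q\<^sup>2"
      unfolding card_vectors_of_points_on_line[OF K(1)] by (simp add: mult.left_commute)
    then show "2 * int (card {x \<in> ?V. Z (dot3 w x)}) \<le> int m * int q ^ 2"
      unfolding of_nat_power[symmetric] of_nat_mult[symmetric] of_nat_le_iff[symmetric, where ?'a = int]
      by simp
  qed auto
  then have "int m * (2 * int k) \<le> int m * (int q ^ 4 - int q)"
    unfolding card_vectors_of_points[OF K(1)] K(2) by (simp add: algebra_simps)
  then have "2 * int k \<le> int q ^ 4 - int q" using m_pos by simp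
  also have "\<dots> = int (q ^ 4 - q)" using q_le_q4 by (simp add: of_nat_diff)
  finally have "2 * k \<le> q ^ 4 - q" by linarith
  then show ?thesis by linarith
qed

lemma ex_proj_arc:
  "\<exists>K. proj_arc R K ((q ^ 4 - q) div 2) (q\<^sup>2 div 2)
    \<and> (\<forall>L \<in> PHG_lines R. card {P \<in> K. P \<subseteq> L} = 0 \<or> card {P \<in> K. P \<subseteq> L} = q\<^sup>2 div 2)"
proof -
  obtain V where V: "V \<subseteq> U3" and closed: "\<And>x y. x \<in> V \<Longrightarrow> y \<in> U3 \<Longrightarrow> par x y \<Longrightarrow> y \<in> V"
    and cardV: "2 * int (card V) = int m * (int q ^ 4 - int q)"
    and lines: "\<And>w. w \<in> U3 \<Longrightarrow> card {x \<in> V. Z (dot3 w x)} = 0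
        \<or> 2 * int (card {x \<in> V. Z (dot3 w x)}) = int m * int q ^ 2"
    using ex_two_intersection_arc by blast
  define K where "K = pt ` V"
  have K: "K \<subseteq> PHG_points R" unfolding K_def PHG_points_eq using V by blast
  have "x \<in> V" if "x \<in> U3" "y \<in> V" "pt x = pt y" for x y
  proof -
    have "\<not> all3 N x" "\<not> all3 N y" using that V by (auto simp: U3_def)
    then have "par y x" using pt_eq_iff that(3) by metis
    then show ?thesis using closed that by blast
  qed
  then have VK: "{x \<in> U3. pt x \<in> K} = V" unfolding K_def using V by blast
  have "int m * (2 * int (card K)) = int m * (int q ^ 4 - int q)"
    using cardV card_vectors_of_points[OF K] unfolding VK by simp
  then have "2 * int (card K) = int q ^ 4 - int q" using m_pos by simp
  also have "\<dots> = int (q ^ 4 - q)" using q_le_q4 by (simp add: of_nat_diff)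
  finally have cardK: "card K = (q ^ 4 - q) div 2" by linarith
  have int: "card {P \<in> K. P \<subseteq> L} = 0 \<or> card {P \<in> K. P \<subseteq> L} = q\<^sup>2 div 2"
    if L: "L \<in> PHG_lines R" for L
  proof -
    obtain w where w: "w \<in> U3" "L = ln w" using L unfolding PHG_lines_eq by blast
    have c: "card {x \<in> V. Z (dot3 w x)} = m * card {P \<in> K. P \<subseteq> L}"
      using card_vectors_of_points_on_line[OF K] unfolding VK w(2) .
    show ?thesis
      using lines[OF w(1)] unfolding c
    proof
      assume "m * card {P \<in> K. P \<subseteq> L} = 0"
      then show ?thesis using m_pos by simp
    next
      assume "2 * int (m * card {P \<in> K. P \<subseteq> L}) = int m * int q ^ 2"
      then have "int m * (2 * int (card {P \<in> K. P \<subseteq> L})) = int m * int (q ^ 2)" by simp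
      then have "2 * int (card {P \<in> K. P \<subseteq> L}) = int (q ^ 2)" using m_pos by simp
      then show ?thesis by linarith
    qed
  qed
  then have "card {P \<in> K. P \<subseteq> L} \<le> q\<^sup>2 div 2" if "L \<in> PHG_lines R" for L
    using that by fastforce
  then show ?thesis using K cardK int unfolding proj_arc_def by blast
qed

lemma max_arc_eq: "max_arc R (q\<^sup>2 div 2) = (q ^ 4 - q) div 2"
  unfolding max_arc_def
proof (rule Max_eqI)
  \<comment> \<open>Finiteness of the set of sizes is what gives \<open>Max\<close> its intended
    meaning.\<close>
  show "finite {k. \<exists>K. proj_arc R K k (q\<^sup>2 div 2)}"
    by (rule finite_subset[of _ "{..(q ^ 4 - q) div 2}"]) (use arc_card_le in blast, simp)
  show "k \<le> (q ^ 4 - q) div 2" if "k \<in> {k. \<exists>K. proj_arc R K k (q\<^sup>2 div 2)}" for k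
    using that arc_card_le by blast
  show "(q ^ 4 - q) div 2 \<in> {k. \<exists>K. proj_arc R K k (q\<^sup>2 div 2)}"
    using ex_proj_arc by blast
qed

end

section \<open>The Galois ring\<close>

text \<open>The coefficient ring may have zero divisors, but a leading coefficient 1 cannot cancel
  the other one.\<close>

lemma degree_monic_mult:
  fixes g h :: "'a::comm_ring_1 poly"
  assumes "lead_coeff h = 1" "g \<noteq> 0"
  shows "degree (h * g) = degree h + degree g" "h * g \<noteq> 0"
proof -
  have "coeff (h * g) (degree h + degree g) = lead_coeff g"
    using assms(1) by (simp add: coeff_mult_degree_sum)
  then have "coeff (h * g) (degree h + degree g) \<noteq> 0" using assms(2) by simp
  then show "degree (h * g) = degree h + degree g" "h * g \<noteq> 0"
    using degree_mult_le[of h g] le_degree by (auto intro: antisym)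
qed

text \<open>Pseudo-division multiplies the dividend by a power of the leading coefficient, which is
  1 here.\<close>

lemma monic_division:
  fixes h x :: "'a::comm_ring_1 poly"
  assumes "lead_coeff h = 1"
  shows "\<exists>g y. x = h * g + y \<and> (y = 0 \<or> degree y < degree h)"
proof -
  obtain g y where gy: "pseudo_divmod x h = (g, y)" by fastforce
  have "h \<noteq> 0" using assms by auto
  from pseudo_divmod[OF this gy] show ?thesis using assms by (intro exI[of _ g] exI[of _ y]) simp
qed

lemma Z4_cases: "(x::4) = 0 \<or> x = 1 \<or> x = 2 \<or> x = 3"
proof (cases x)
  case (of_int z)
  then have "z = 0 \<or> z = 1 \<or> z = 2 \<or> z = 3" by auto
  then show ?thesis using of_int by auto
qed

lemma Z2_cases: "(x::2) = 0 \<or> x = 1"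
proof (cases x)
  case (of_int z)
  then have "z = 0 \<or> z = 1" by auto
  then show ?thesis using of_int by auto
qed

abbreviation red :: "4 \<Rightarrow> 2" where "red a \<equiv> of_int (Rep_bit0 a)"

lemma red_simps [simp]: "red 0 = 0" "red 1 = 1" "red 2 = 0" "red 3 = 1"
  by (simp_all add: bit0.Rep_0 bit0.Rep_1 bit0.Rep_numeral)

lemma numeral_eq_mod [simp]:
  "(4::4) = 0" "(5::4) = 1" "(6::4) = 2" "(9::4) = 1" "(2::2) = 0"
  by simp_all

lemma red_add: "red (a + b) = red a + red b"
  using Z4_cases[of a] Z4_cases[of b] by auto

lemma red_mult: "red (a * b) = red a * red b"
  using Z4_cases[of a] Z4_cases[of b] by auto

lemma red_sum: "red (sum f A) = (\<Sum>x\<in>A. red (f x))"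
  by (induction A rule: infinite_finite_induct) (auto simp: red_add)

lemma coeff_red2: "coeff (red2 p) i = red (coeff p i)"
  unfolding red2_def by (rule coeff_map_poly) simp

lemma red2_add: "red2 (p + p') = red2 p + red2 p'"
  by (rule poly_eqI) (simp add: coeff_red2 red_add)

lemma red2_mult: "red2 (p * p') = red2 p * red2 p'"
  by (rule poly_eqI) (simp add: coeff_red2 coeff_mult red_sum red_mult)

lemma red2_one: "red2 1 = 1"
  by (rule poly_eqI) (simp add: coeff_red2)

lemma two_dvd_if_coeff:
  assumes "\<And>i. coeff p i = 0 \<or> coeff p i = 2"
  shows "(2 :: 4 poly) dvd p"
proof
  show "p = 2 * map_poly (\<lambda>a. if a = 2 then 1 else 0) p"
  proof (rule poly_eqI)
    fix i
    show "coeff p i = coeff (2 * map_poly (\<lambda>a. if a = 2 then 1 else 0) p) i"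
      using assms[of i] by (auto simp: numeral_poly coeff_map_poly)
  qed
qed

lemma two_dvd_if_red2: "red2 p = 0 \<Longrightarrow> 2 dvd p"
proof (rule two_dvd_if_coeff)
  fix i assume "red2 p = 0"
  then have "red (coeff p i) = 0" by (simp flip: coeff_red2)
  then show "coeff p i = 0 \<or> coeff p i = 2" using Z4_cases[of "coeff p i"] by auto
qed

lemma two_dvd_if_two_mult: "2 * p = 0 \<Longrightarrow> (2 :: 4 poly) dvd p"
proof (rule two_dvd_if_coeff)
  fix i assume "2 * p = 0"
  then have "coeff p i + coeff p i = 0" by (metis coeff_0 coeff_add mult_2)
  then show "coeff p i = 0 \<or> coeff p i = 2" using Z4_cases[of "coeff p i"] by auto
qed

lemma four_poly: "(4 :: 4 poly) = 0"
  by (simp add: numeral_poly)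

lemma two_poly: "(2 :: 4 poly) \<noteq> 0"
  by (simp add: numeral_poly)

lemma red2_surj: "\<exists>p. red2 p = p'"
proof
  show "red2 (map_poly (\<lambda>a. if a = 0 then 0 else 1) p') = p'"
  proof (rule poly_eqI)
    fix i
    show "coeff (red2 (map_poly (\<lambda>a. if a = 0 then 0 else 1) p')) i = coeff p' i"
      using Z2_cases[of "coeff p' i"] by (auto simp: coeff_red2 coeff_map_poly)
  qed
qed

lemma red2_diff: "red2 (p - p') = red2 p - red2 p'"
  using red2_add[of "p - p'" p'] by simp

lemma lead_coeff_Z2: "(p :: 2 poly) \<noteq> 0 \<Longrightarrow> lead_coeff p = 1"
  using Z2_cases[of "lead_coeff p"] by auto

text \<open>The usual argument with a nonzero element \<open>d\<close> of least degree in the ideal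
  of \<open>x\<close> and \<open>f\<close>. Every nonzero polynomial over the field of two elements
  is monic, so division by \<open>d\<close> is available.\<close>

lemma bezout_irreducible:
  fixes f x :: "2 poly"
  assumes irr: "Factorial_Ring.irreducible f" and nd: "\<not> f dvd x"
  shows "\<exists>a b. a * x + b * f = 1"
proof -
  define J where "J = {p. p \<noteq> 0 \<and> (\<exists>a b. p = a * x + b * f)}"
  have "f \<noteq> 0" using irr by auto
  moreover have "f = 0 * x + 1 * f" by simp
  ultimately have "f \<in> J" unfolding J_def by blast
  then obtain d where d: "d \<in> J" and min: "\<And>p. p \<in> J \<Longrightarrow> degree d \<le> degree p"
    using ex_has_least_nat[of "\<lambda>p. p \<in> J" f degree] by blast
  obtain a b where ab: "d = a * x + b * f" and d0: "d \<noteq> 0" using d by (auto simp: J_def)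
  have dvd: "d dvd p" if p: "p = s * x + t * f" for p s t
  proof -
    obtain g y where gy: "p = d * g + y" "y = 0 \<or> degree y < degree d"
      using monic_division[OF lead_coeff_Z2[OF d0]] by blast
    have "y = (s - a * g) * x + (t - b * g) * f"
      using gy(1) unfolding p ab by (simp add: algebra_simps)
    then have "y \<noteq> 0 \<Longrightarrow> y \<in> J" unfolding J_def by blast
    then have "y = 0" using min gy(2) by fastforce
    then show ?thesis using gy(1) by simp
  qed
  have "d dvd f" by (rule dvd[of f 0 1]) simp
  then obtain e where e: "f = d * e" by (elim dvdE)
  have "d dvd x" by (rule dvd[of x 1 0]) simp
  then obtain g where g: "x = d * g" by (elim dvdE)
  have "d dvd 1 \<or> e dvd 1" using irr e unfolding Factorial_Ring.irreducible_def by blast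
  then show ?thesis
  proof
    assume "d dvd 1"
    then obtain k where "1 = d * k" by (elim dvdE)
    then have "(a * k) * x + (b * k) * f = 1" unfolding ab by (simp add: algebra_simps)
    then show ?thesis by blast
  next
    assume "e dvd 1"
    then obtain k where "1 = e * k" by (elim dvdE)
    then have "x = f * (k * g)" unfolding g e by (metis mult.assoc mult.right_neutral)
    then show ?thesis using nd by simp
  qed
qed

lemma card_degree_less:
  assumes "r \<ge> 1"
  shows "finite {p :: 4 poly. degree p < r}" "card {p :: 4 poly. degree p < r} = 4 ^ r"
proof -
  have "bij_betw (\<lambda>p. \<lambda>i\<in>{..<r}. coeff p i) {p :: 4 poly. degree p < r} ({..<r} \<rightarrow>\<^sub>E UNIV)"
    unfolding bij_betw_def
  proof
    show "inj_on (\<lambda>p. \<lambda>i\<in>{..<r}. coeff p i) {p :: 4 poly. degree p < r}"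
    proof (rule inj_onI)
      fix p p' :: "4 poly"
      assume *: "p \<in> {p. degree p < r}" "p' \<in> {p. degree p < r}"
        "(\<lambda>i\<in>{..<r}. coeff p i) = (\<lambda>i\<in>{..<r}. coeff p' i)"
      show "p = p'"
      proof (rule poly_eqI)
        fix i
        show "coeff p i = coeff p' i"
          using fun_cong[OF *(3), of i] *(1,2) by (cases "i < r") (auto simp: coeff_eq_0)
      qed
    qed
    show "(\<lambda>p. \<lambda>i\<in>{..<r}. coeff p i) ` {p :: 4 poly. degree p < r} = ({..<r} \<rightarrow>\<^sub>E UNIV)"
    proof (intro equalityI subsetI)
      fix f :: "nat \<Rightarrow> 4" assume f: "f \<in> ({..<r} \<rightarrow>\<^sub>E UNIV)"
      define p where "p = (\<Sum>i<r. monom (f i) i)"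
      have cp: "coeff p i = (if i < r then f i else 0)" for i
        by (simp add: p_def coeff_sum)
      \<comment> \<open>The zero polynomial has degree 0, so \<open>degree p < r\<close> describes
        the polynomials with \<open>r\<close> free coefficients only for
        \<open>r \<ge> 1\<close>.\<close>
      have "degree p \<le> r - 1" by (rule degree_le) (use assms cp in auto)
      then have "degree p < r" using assms by linarith
      moreover have "f = (\<lambda>i\<in>{..<r}. coeff p i)"
        using f by (auto simp: cp PiE_iff extensional_def)
      ultimately show "f \<in> (\<lambda>p. \<lambda>i\<in>{..<r}. coeff p i) ` {p. degree p < r}" by blast
    qed (auto simp: PiE_iff split: if_splits)
  qed
  note bij = this
  have "finite ({..<r} \<rightarrow>\<^sub>E (UNIV :: 4 set))" by (intro finite_PiE) auto
  then show "finite {p :: 4 poly. degree p < r}" using bij_betw_finite[OF bij] by blast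
  show "card {p :: 4 poly. degree p < r} = 4 ^ r"
    using bij_betw_same_card[OF bij] by (simp add: card_PiE)
qed

section \<open>The ring axioms for the quotient by the modulus\<close>

context
  fixes h :: "4 poly" and r :: nat
  assumes r: "r \<ge> 1" and h: "galois_modulus r h"
begin

lemma monic_h: "lead_coeff h = 1" and degree_h: "degree h = r"
  and irreducible_h: "Factorial_Ring.irreducible (red2 h)"
  using h by (auto simp: galois_modulus_def)

lemma not_dvd_two: "\<not> h dvd 2"
proof
  assume "h dvd 2"
  then obtain g where g: "2 = h * g" by (elim dvdE)
  then have "g \<noteq> 0" using two_poly by auto
  then have "degree (2 :: 4 poly) = r + degree g"
    using degree_monic_mult(1)[OF monic_h] degree_h g by metis
  then show False using r by (simp add: numeral_poly)
qed

lemma red2_h_nonzero: "red2 h \<noteq> 0"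
  using irreducible_h by auto

text \<open>If \<open>2 x = h g\<close>, then \<open>h g\<close> vanishes modulo 2, and so does
  \<open>g\<close> because \<open>h\<close> is monic there. With \<open>g = 2 g'\<close> the
  polynomial \<open>x - h g'\<close> is killed by 2, hence even.\<close>

lemma two_dvd_mod:
  assumes "h dvd 2 * x"
  shows "\<exists>y. h dvd x - 2 * y"
proof -
  obtain g where g: "2 * x = h * g" using assms by (elim dvdE)
  have red_two: "red2 2 = 0" by (rule poly_eqI) (simp add: coeff_red2 numeral_poly coeff_pCons split: nat.split)
  have "red2 h * red2 g = 0" using red2_mult[of 2 x] red2_mult[of h g] g red_two by simp
  then have "red2 g = 0"
    using degree_monic_mult(2)[OF lead_coeff_Z2[OF red2_h_nonzero]] by blast
  from two_dvd_if_red2[OF this] obtain g' where g': "g = 2 * g'" by (elim dvdE)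
  have "2 * (x - h * g') = 0" using g unfolding g' by (simp add: algebra_simps)
  from two_dvd_if_two_mult[OF this] obtain y where "x - h * g' = 2 * y" by (elim dvdE)
  then have "x - 2 * y = h * g'" by (simp add: algebra_simps)
  then show ?thesis by (metis dvd_triv_left)
qed

text \<open>Bezout modulo 2 lifts to \<open>a x = 1 + 2 w\<close> modulo \<open>h\<close>, and
  \<open>1 + 2 w\<close> has the inverse \<open>1 - 2 w\<close> because
  \<open>4 = 0\<close>.\<close>

lemma unit_mod:
  assumes "\<not> h dvd 2 * x"
  shows "\<exists>y. h dvd x * y - 1"
proof -
  have "\<not> red2 h dvd red2 x"
  proof
    assume "red2 h dvd red2 x"
    then obtain G where "red2 x = red2 h * G" by (elim dvdE)
    moreover obtain g where "red2 g = G" using red2_surj by blast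
    ultimately have "red2 (x - h * g) = 0" by (simp add: red2_diff red2_mult)
    from two_dvd_if_red2[OF this] obtain y where "x - h * g = 2 * y" by (elim dvdE)
    then have "x = h * g + 2 * y" by (simp add: algebra_simps)
    then have "2 * x = h * (2 * g) + 4 * y" by (simp add: algebra_simps)
    then show False using assms four_poly by simp
  qed
  then obtain A B where AB: "A * red2 x + B * red2 h = 1"
    using bezout_irreducible[OF irreducible_h] by blast
  obtain a b where ab: "red2 a = A" "red2 b = B" using red2_surj by metis
  have "red2 (a * x + b * h - 1) = 0"
    using AB by (simp add: red2_diff red2_add red2_mult red2_one ab)
  from two_dvd_if_red2[OF this] obtain w where "a * x + b * h - 1 = 2 * w" by (elim dvdE)
  then have ax: "a * x = 1 + 2 * w - b * h" by (simp add: algebra_simps)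
  have "x * (a * (1 - 2 * w)) - 1 = (a * x) * (1 - 2 * w) - 1" by (simp add: algebra_simps)
  also have "\<dots> = h * (- b * (1 - 2 * w)) - 4 * (w * w)" unfolding ax by (simp add: algebra_simps)
  finally have "x * (a * (1 - 2 * w)) - 1 = h * (- b * (1 - 2 * w))" using four_poly by simp
  then show ?thesis by (metis dvd_triv_left)
qed

lemma ex1_remainder: "\<exists>!c. c \<in> {p. degree p < r} \<and> h dvd x - c"
proof -
  obtain g y where gy: "x = h * g + y" "y = 0 \<or> degree y < degree h"
    using monic_division[OF monic_h] by blast
  show ?thesis
  proof (rule ex1I[of _ y])
    show "y \<in> {p. degree p < r} \<and> h dvd x - y"
      using gy r degree_h by auto
  next
    fix c assume c: "c \<in> {p. degree p < r} \<and> h dvd x - c"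
    then obtain k where k: "x - c = h * k" by (auto elim: dvdE)
    have "y - c = h * (k - g)" using k gy(1) by (simp add: algebra_simps)
    moreover have "degree (y - c) < r"
      using gy(2) c r degree_h by (auto intro: degree_diff_less)
    ultimately have "k - g = 0"
      using degree_monic_mult(1)[OF monic_h, of "k - g"] degree_h by (cases "k - g = 0") auto
    then show "c = y" using \<open>y - c = h * (k - g)\<close> by simp
  qed
qed

section \<open>Operations on the cosets of the modulus\<close>

lemma PIdl_h: "PIdl\<^bsub>Z4poly_ring\<^esub> h = {x. h dvd x}"
  by (auto simp: cgenideal_def Z4poly_ring_def dvd_def mult.commute)

lemma coset_h: "{x. h dvd x} +>\<^bsub>Z4poly_ring\<^esub> x = {y. h dvd y - x}"
proof -
  have "{x. h dvd x} +>\<^bsub>Z4poly_ring\<^esub> x = (\<lambda>i. i + x) ` {x. h dvd x}"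
    unfolding a_r_coset_def' by (simp add: Z4poly_ring_def UNION_singleton_eq_range)
  also have "\<dots> = {y. h dvd y - x}"
  proof (intro equalityI subsetI)
    fix y assume "y \<in> {y. h dvd y - x}"
    then show "y \<in> (\<lambda>i. i + x) ` {x. h dvd x}" by (intro image_eqI[of _ _ "y - x"]) simp_all
  qed auto
  finally show ?thesis .
qed

definition coset :: "4 poly \<Rightarrow> 4 poly set" where
  "coset x = {y. h dvd y - x}"

lemma carrier_galois_ring: "carrier (galois_ring h) = range coset"
  unfolding galois_ring_def FactRing_def PIdl_h A_RCOSETS_def' coset_h coset_def
  by (auto simp: Z4poly_ring_def)

lemma coset_eq: "coset x = coset y \<longleftrightarrow> h dvd x - y"
proof
  assume "coset x = coset y"
  moreover have "x \<in> coset x" by (simp add: coset_def)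
  ultimately show "h dvd x - y" by (simp add: coset_def)
next
  assume d: "h dvd x - y"
  have "h dvd z - x \<longleftrightarrow> h dvd z - y" for z
    using dvd_add_left_iff[OF d, of "z - x"] by simp
  then show "coset x = coset y" by (simp add: coset_def)
qed

lemma coset_add: "coset x \<oplus>\<^bsub>galois_ring h\<^esub> coset y = coset (x + y)"
proof -
  have "coset x <+>\<^bsub>Z4poly_ring\<^esub> coset y = coset (x + y)"
  proof (intro equalityI subsetI)
    fix z assume "z \<in> coset x <+>\<^bsub>Z4poly_ring\<^esub> coset y"
    then obtain a b where ab: "h dvd a - x" "h dvd b - y" "z = a + b"
      by (auto simp: set_add_def' coset_def Z4poly_ring_def)
    have eq: "z - (x + y) = (a - x) + (b - y)" using ab(3) by simp
    show "z \<in> coset (x + y)"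
      unfolding coset_def mem_Collect_eq eq by (rule dvd_add[OF ab(1,2)])
  next
    fix z assume "z \<in> coset (x + y)"
    then have "z - y \<in> coset x" "y \<in> coset y" "z = (z - y) + y"
      by (auto simp: coset_def algebra_simps)
    then show "z \<in> coset x <+>\<^bsub>Z4poly_ring\<^esub> coset y"
      unfolding set_add_def' Z4poly_ring_def ring_record_simps by blast
  qed
  then show ?thesis by (simp add: galois_ring_def FactRing_def)
qed

lemma coset_mult: "coset x \<otimes>\<^bsub>galois_ring h\<^esub> coset y = coset (x * y)"
proof -
  have "rcoset_mult Z4poly_ring {x. h dvd x} (coset x) (coset y) =
      (\<Union>a\<in>coset x. \<Union>b\<in>coset y. coset (a * b))"
    unfolding rcoset_mult_def coset_h by (simp add: coset_def Z4poly_ring_def)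
  \<comment> \<open>The product of cosets is a union over pairs of representatives, and all its
    members are the same coset.\<close>
  also have "\<dots> = (\<Union>a\<in>coset x. \<Union>b\<in>coset y. coset (x * y))"
  proof (intro SUP_cong refl)
    fix a b assume "a \<in> coset x" "b \<in> coset y"
    then have "h dvd (a - x) * b + x * (b - y)" by (simp add: coset_def)
    then show "coset (a * b) = coset (x * y)" unfolding coset_eq by (simp add: algebra_simps)
  qed
  also have "\<dots> = coset (x * y)"
  proof -
    have "x \<in> coset x" "y \<in> coset y" by (auto simp: coset_def)
    then show ?thesis by blast
  qed
  finally show ?thesis by (simp add: galois_ring_def FactRing_def PIdl_h)
qed

end

theorem theorem3p11:
  fixes r :: nat and h :: "4 poly"
  assumes "r \<ge> 1" and "galois_modulus r h"
  defines "q \<equiv> (2::nat) ^ r"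
  shows "(\<exists>K. proj_arc (galois_ring h) K ((q^4 - q) div 2) (q^2 div 2)
            \<and> (\<forall>L \<in> PHG_lines (galois_ring h).
                 card {P \<in> K. P \<subseteq> L} = 0 \<or> card {P \<in> K. P \<subseteq> L} = q^2 div 2))
         \<and> max_arc (galois_ring h) (q^2 div 2) = (q^4 - q) div 2"
proof -
  interpret G: galois_quotient "\<lambda>x. h dvd x" "{p. degree p < r}" "galois_ring h" "coset h"
  proof unfold_locales
    show "finite {p :: 4 poly. degree p < r}" by (rule card_degree_less(1)[OF assms(1)])
    show "\<exists>!c. c \<in> {p. degree p < r} \<and> h dvd x - c" for x
      by (rule ex1_remainder[OF assms(1,2)])
    show "\<not> h dvd 2" by (rule not_dvd_two[OF assms(1,2)])
    show "\<exists>y. h dvd x - 2 * y" if "h dvd 2 * x" for x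
      by (rule two_dvd_mod[OF assms(1,2) that])
    show "\<exists>y. h dvd x * y - 1" if "\<not> h dvd 2 * x" for x
      by (rule unit_mod[OF assms(1,2) that])
    show "carrier (galois_ring h) = range (coset h)" by (rule carrier_galois_ring[OF assms(1,2)])
    show "coset h x = coset h y \<longleftrightarrow> h dvd x - y" for x y by (rule coset_eq[OF assms(1,2)])
    show "coset h x \<otimes>\<^bsub>galois_ring h\<^esub> coset h y = coset h (x * y)" for x y
      by (rule coset_mult[OF assms(1,2)])
    show "coset h x \<oplus>\<^bsub>galois_ring h\<^esub> coset h y = coset h (x + y)" for x y
      by (rule coset_add[OF assms(1,2)])
  qed (simp_all add: four_poly)
  \<comment> \<open>The parameter \<open>G.q\<close> is identified through the number of remainders:
    \<open>G.q^2\<close> is the number \<open>4 ^ r\<close> of polynomials of degree below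
    \<open>r\<close>.\<close>
  have "(2 ^ r)\<^sup>2 = (4::nat) ^ r"
    by (simp add: power2_eq_square flip: power_mult_distrib)
  then have "G.q\<^sup>2 = (2 ^ r)\<^sup>2"
    using G.card_C card_degree_less(2)[OF assms(1)] by simp
  then have "G.q = q" unfolding q_def by simp
  then show ?thesis using G.ex_proj_arc G.max_arc_eq by simp
qed

end
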